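(* Let $t_0=\frac12+\frac{1}{2\sqrt3}$, $\alpha\in(0,1)\cup(1,\infty)$, $t>0$, and $G_{\alpha,t}(\lambda)=\Gamma(t)^{1-\alpha}\,\alpha^{\alpha\lambda}\,\frac{\Gamma(\lambda+t)^\alpha}{\Gamma(\alpha\lambda+t)}$, $\lambda\ge0$. 1) $G_{\alpha,t}$ is the Laplace transform of a random variable $X_{\alpha,t}\sim\mathrm{SD}_0(\mathbb{R}_+)$ if and only if $\alpha\in(0,1)$ and $t\ge t_0$. 2) $1/G_{\alpha,t}$ is the Laplace transform of a random variable $Y_{\alpha,t}\sim\mathrm{SD}_0(\mathbb{R}_+)$ if and only if $\alpha\in(1,\infty)$ and $t\ge t_0$.
   Context: A nonnegative random variable $X$ is in $\mathrm{SD}_0(\mathbb{R}_+)$ (selfdecomposable) if for every $c\in(0,1)$ there is a random variable $V_c$ independent of $X$ with $X\overset{d}{=}cX+V_c$. Equivalently, $-\log\mathbb{E}[e^{-\lambda X}]=d\lambda+\int_0^\infty(1-e^{-\lambda x})\frac{k(x)}{x}dx$ with $d\ge0$ and $k\ge 0$ non-increasing. *)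

theory Defs
  imports "HOL-Probability.Probability"
begin

definition nonneg_distr :: "real measure \<Rightarrow> bool" where
  "nonneg_distr M \<longleftrightarrow> prob_space M \<and> sets M = sets borel \<and> (AE x in M. 0 \<le> x)"

definition laplace_tr :: "real measure \<Rightarrow> real \<Rightarrow> real" where
  "laplace_tr M lam = (\<integral>x. exp (- lam * x) \<partial>M)"

text \<open>Selfdecomposability of the law M of X: for every c in (0,1) there is a random variable
V_c independent of X with X =d cX + V_c, i.e. the law of X is the convolution of the law
of cX with the law N of V_c.\<close>
definition selfdecomposable :: "real measure \<Rightarrow> bool" where
  "selfdecomposable M \<longleftrightarrow>
     (\<forall>c::real. 0 < c \<and> c < 1 \<longrightarrow>
        (\<exists>N. prob_space N \<and> sets N = sets borel \<and>
             M = convolution (distr M borel (\<lambda>x. c * x)) N))"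

definition SD0_Rplus :: "real measure \<Rightarrow> bool" where
  "SD0_Rplus M \<longleftrightarrow> nonneg_distr M \<and> selfdecomposable M"

definition t0 :: real where
  "t0 = 1/2 + 1 / (2 * sqrt 3)"

definition G :: "real \<Rightarrow> real \<Rightarrow> real \<Rightarrow> real" where
  "G \<alpha> t lam = Gamma t powr (1 - \<alpha>) * \<alpha> powr (\<alpha> * lam) * Gamma (lam + t) powr \<alpha> / Gamma (\<alpha> * lam + t)"

end

theory Submission
  imports Defs "HOL-Real_Asymp.Real_Asymp"
begin

text \<open>Since \<open>1 / G \<alpha> t \<lambda> = (G (1/\<alpha>) t (\<alpha>\<lambda>)) powr \<alpha>\<close>, both parts reduce to \<open>h = ln G\<close> for \<open>\<alpha> < 1\<close>. The series of the
  trigamma function gives \<open>\<psi>'(\<lambda> + t) = \<integral> exp (-\<lambda>x) u(x) dx\<close> with \<open>u(x) = x exp (-tx) / (1 - exp (-x))\<close>.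
  Integrating \<open>h''(\<lambda>) = \<alpha> \<psi>'(\<lambda> + t) - \<alpha>\<^sup>2 \<psi>'(\<alpha>\<lambda> + t)\<close> twice with Tonelli yields
  \<open>-h(\<lambda>) = \<integral> (1 - exp (-\<lambda>x)) k(x) / x dx\<close> with \<open>k(x) = \<alpha> (u(x) - u(x/\<alpha>)) / x\<close>, which is nonnegative and
  nonincreasing as soon as \<open>u\<close> is convex and nonincreasing; this holds for \<open>t \<ge> t0\<close>. The law itself is a weak limit
  of compound Poisson laws, and its decomposition \<open>X = cX + V\<close> follows from uniqueness of Laplace transforms, the Levy
  density of \<open>V\<close> being \<open>(k(x) - k(x/c)) / x \<ge> 0\<close>.

  Conversely, Laplace transforms are log-convex, so for a selfdecomposable law both \<open>h(\<lambda>)\<close> and \<open>h(\<lambda>) - h(c\<lambda>)\<close> are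
  convex: \<open>\<lambda>\<^sup>2 h''(\<lambda>)\<close> is nonnegative and nondecreasing. Its expansion
  \<open>(1 - \<alpha>)(t - 1/2) - (1/\<alpha> - \<alpha>)(t\<^sup>2 - t + 1/6)/\<lambda> + o(1/\<lambda>)\<close> at infinity then forces \<open>t \<ge> 1/2\<close> and
  \<open>t\<^sup>2 - t + 1/6 \<ge> 0\<close>, that is \<open>t \<ge> t0\<close>. The wrong range of \<open>\<alpha>\<close> is excluded because \<open>-h\<close> is strictly concave
  near \<open>0\<close>: \<open>h''(0) = \<alpha>(1 - \<alpha>) \<psi>'(t) > 0\<close>.\<close>

section \<open>Laplace transforms of nonnegative laws\<close>

lemma nonneg_distr_D:
  assumes "nonneg_distr M"
  shows "prob_space M" "sets M = sets borel" "AE x in M. 0 \<le> x" "space M = UNIV"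
  using assms by (auto simp: nonneg_distr_def dest: sets_eq_imp_space_eq)

lemma integrable_laplace:
  assumes M: "nonneg_distr M" and "0 \<le> l"
  shows "integrable M (\<lambda>x. exp (- l * x))"
proof -
  interpret prob_space M using M by (rule nonneg_distr_D)
  have [measurable_cong]: "sets M = sets borel" using M by (rule nonneg_distr_D)
  have "AE x in M. norm (exp (- l * x)) \<le> 1"
    using nonneg_distr_D(3)[OF M] by eventually_elim (use \<open>0 \<le> l\<close> in simp)
  then show ?thesis
    by (intro integrable_const_bound[where B = 1]) auto
qed

lemma nn_integral_laplace:
  assumes "nonneg_distr M" and "0 \<le> l"
  shows "(\<integral>\<^sup>+x. ennreal (exp (- l * x)) \<partial>M) = ennreal (laplace_tr M l)"
  unfolding laplace_tr_def
  using integrable_laplace[OF assms] by (intro nn_integral_eq_integral) auto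

lemma laplace_tr_nonneg: "0 \<le> laplace_tr M l"
  unfolding laplace_tr_def by (rule integral_nonneg_AE) simp

text \<open>Transforms of convolutions and mixtures are computed with the nonnegative integral,
  where Tonelli needs no integrability; this rule carries the value back to
  \<open>laplace_tr\<close>.\<close>

lemma laplace_trI:
  assumes "(\<integral>\<^sup>+x. ennreal (exp (- l * x)) \<partial>M) = ennreal a" "0 \<le> a" "sets M = sets borel"
  shows "laplace_tr M l = a"
  unfolding laplace_tr_def
  by (subst integral_eq_nn_integral) (use assms in \<open>simp_all add: measurable_cong_sets[OF assms(3) refl]\<close>)

lemma (in prob_space) integral_exp_pos:
  fixes f :: "'a \<Rightarrow> real"
  assumes "integrable M (\<lambda>x. exp (f x))"
  shows "0 < (\<integral>x. exp (f x) \<partial>M)"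
proof -
  have "(\<integral>x. exp (f x) \<partial>M) \<noteq> 0"
    using assms by (subst integral_nonneg_eq_0_iff_AE) auto
  moreover have "0 \<le> (\<integral>x. exp (f x) \<partial>M)" by (rule integral_nonneg_AE) simp
  ultimately show ?thesis by (metis less_le)
qed

lemma laplace_tr_pos:
  assumes "nonneg_distr M" "0 \<le> l"
  shows "0 < laplace_tr M l"
  unfolding laplace_tr_def
  by (rule prob_space.integral_exp_pos[OF nonneg_distr_D(1) integrable_laplace]) fact+

lemma nonneg_distr_convolution:
  assumes M: "nonneg_distr M" and N: "nonneg_distr N"
  shows "nonneg_distr (M \<star> N)"
proof -
  interpret M: prob_space M using M by (rule nonneg_distr_D)
  interpret N: prob_space N using N by (rule nonneg_distr_D)
  interpret pair_prob_space M N ..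
  have [measurable_cong]: "sets M = sets borel" "sets N = sets borel"
    using M N by (auto dest: nonneg_distr_D)
  have "prob_space (M \<star> N)"
    unfolding convolution_def by (intro prob_space_distr) measurable
  moreover have "AE x in M \<star> N. 0 \<le> x"
  proof -
    have "AE p in M \<Otimes>\<^sub>M N. 0 \<le> fst p + snd p"
    proof (rule AE_pair_measure)
      show "{x \<in> space (M \<Otimes>\<^sub>M N). 0 \<le> fst x + snd x} \<in> sets (M \<Otimes>\<^sub>M N)" by measurable
      show "AE x in M. AE y in N. 0 \<le> fst (x, y) + snd (x, y)"
        using nonneg_distr_D(3)[OF M]
      proof eventually_elim
        case (elim x)
        show ?case using nonneg_distr_D(3)[OF N] by eventually_elim (use elim in simp)
      qed
    qed
    then show ?thesis
      unfolding convolution_def by (subst AE_distr_iff) (auto simp: case_prod_beta')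
  qed
  ultimately show ?thesis by (simp add: nonneg_distr_def)
qed

lemma laplace_tr_convolution:
  assumes M: "nonneg_distr M" and N: "nonneg_distr N" and l: "0 \<le> l"
  shows "laplace_tr (M \<star> N) l = laplace_tr M l * laplace_tr N l"
proof (rule laplace_trI)
  interpret M: prob_space M using M by (rule nonneg_distr_D)
  interpret N: prob_space N using N by (rule nonneg_distr_D)
  have [measurable_cong]: "sets M = sets borel" "sets N = sets borel"
    using M N by (auto dest: nonneg_distr_D)
  have "(\<integral>\<^sup>+x. ennreal (exp (- l * x)) \<partial>(M \<star> N))
      = (\<integral>\<^sup>+x. \<integral>\<^sup>+y. ennreal (exp (- l * (x + y))) \<partial>N \<partial>M)"
    by (rule nn_integral_convolution) (use M N in \<open>auto dest: nonneg_distr_D intro: M.finite_measure_axioms N.finite_measure_axioms\<close>)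
  also have "\<dots> = (\<integral>\<^sup>+x. ennreal (exp (- l * x)) * ennreal (laplace_tr N l) \<partial>M)"
    by (rule nn_integral_cong)
       (simp add: distrib_left exp_add exp_diff divide_inverse exp_minus ennreal_mult nn_integral_cmult
          nn_integral_laplace[OF N l, symmetric] flip: exp_minus minus_mult_left)
  also have "\<dots> = ennreal (laplace_tr M l) * ennreal (laplace_tr N l)"
    by (subst nn_integral_multc) (auto simp: nn_integral_laplace[OF M l, simplified])
  finally show "(\<integral>\<^sup>+x. ennreal (exp (- l * x)) \<partial>(M \<star> N)) = ennreal (laplace_tr M l * laplace_tr N l)"
    by (simp add: ennreal_mult laplace_tr_nonneg)
qed (auto simp: laplace_tr_nonneg)

lemma nonneg_distr_scale:
  assumes M: "nonneg_distr M" and c: "0 \<le> c"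
  shows "nonneg_distr (distr M borel (\<lambda>x. c * x))"
proof -
  have [measurable_cong]: "sets M = sets borel" using M by (rule nonneg_distr_D)
  have "AE x in M. 0 \<le> c * x"
    using nonneg_distr_D(3)[OF M] by eventually_elim (use c in simp)
  then show ?thesis
    unfolding nonneg_distr_def using nonneg_distr_D(1)[OF M]
    by (auto intro!: prob_space.prob_space_distr simp: AE_distr_iff)
qed

lemma laplace_tr_scale:
  assumes "sets M = sets borel"
  shows "laplace_tr (distr M borel (\<lambda>x. c * x)) l = laplace_tr M (c * l)"
proof -
  note [measurable_cong] = assms
  show ?thesis
    unfolding laplace_tr_def by (subst integral_distr) (auto simp: ac_simps)
qed

lemma laplace_tr_return: "laplace_tr (return borel a) l = exp (- l * a)"
  unfolding laplace_tr_def by (subst integral_return) auto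

lemma nonneg_distr_return: "0 \<le> a \<Longrightarrow> nonneg_distr (return borel a)"
  by (simp add: nonneg_distr_def prob_space_return AE_return)

section \<open>Log-convexity of Laplace transforms\<close>

text \<open>Hoelder's inequality, obtained from convexity of \<open>exp\<close> at the exponents
  \<open>- a * x - ln ?A\<close> and \<open>- b * x - ln ?B\<close>, whose exponentials integrate to
  1. The support of \<open>N\<close> is left free because the remainder law in a selfdecomposition
  is not known in advance to live on the half-line.\<close>

lemma ln_laplace_tr_convex:
  assumes N: "prob_space N" "convex S"
    and int: "\<And>l. l \<in> S \<Longrightarrow> integrable N (\<lambda>x. exp (- l * x))"
  shows "convex_on S (\<lambda>l. ln (laplace_tr N l))"
  unfolding convex_on_def
proof (intro conjI ballI allI impI)
  interpret prob_space N by fact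
  fix a b u v :: real assume ab: "a \<in> S" "b \<in> S" and uv: "0 \<le> u" "0 \<le> v" "u + v = 1"
  let ?A = "laplace_tr N a" and ?B = "laplace_tr N b" and ?c = "u *\<^sub>R a + v *\<^sub>R b"
  have c: "?c \<in> S" using \<open>convex S\<close> ab uv by (rule convexD)
  have pos: "0 < laplace_tr N l" if "l \<in> S" for l
    unfolding laplace_tr_def using int[OF that] by (rule integral_exp_pos)
  note p = pos[OF ab(1)] pos[OF ab(2)] pos[OF c]
  let ?E = "u * ln ?A + v * ln ?B"
  have "exp (- ?c * x) \<le> exp ?E * (u / ?A * exp (- a * x) + v / ?B * exp (- b * x))" for x
  proof -
    have "exp (u *\<^sub>R (- a * x - ln ?A) + v *\<^sub>R (- b * x - ln ?B))
        \<le> u * exp (- a * x - ln ?A) + v * exp (- b * x - ln ?B)"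
      using convex_onD[OF exp_convex, of v "- a * x - ln ?A" "- b * x - ln ?B"] uv
      by (simp add: eq_diff_eq[THEN iffD2, OF uv(3)])
    also have "\<dots> = u / ?A * exp (- a * x) + v / ?B * exp (- b * x)"
      using p by (simp add: exp_diff)
    finally have "exp ?E * exp (u *\<^sub>R (- a * x - ln ?A) + v *\<^sub>R (- b * x - ln ?B))
        \<le> exp ?E * (u / ?A * exp (- a * x) + v / ?B * exp (- b * x))"
      by simp
    then show ?thesis by (simp add: algebra_simps flip: exp_add)
  qed
  then have "laplace_tr N ?c \<le> (\<integral>x. exp ?E * (u / ?A * exp (- a * x) + v / ?B * exp (- b * x)) \<partial>N)"
    unfolding laplace_tr_def[of _ ?c] using int[OF ab(1)] int[OF ab(2)] int[OF c]
    by (intro integral_mono) (auto simp del: minus_add_distrib)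
  also have "\<dots> = exp ?E * (u / ?A * ?A + v / ?B * ?B)"
    unfolding laplace_tr_def using int[OF ab(1)] int[OF ab(2)] by simp
  also have "\<dots> = exp ?E" using p uv by simp
  finally have "ln (laplace_tr N ?c) \<le> ln (exp ?E)"
    using p by (subst ln_le_cancel_iff) auto
  then show "ln (laplace_tr N ?c) \<le> ?E" by simp
qed fact

lemma convex_on_eq_on:
  assumes "convex_on S f" "\<And>x. x \<in> S \<Longrightarrow> g x = f x"
  shows "convex_on S g"
  using assms by (simp add: convex_on_def convex_def)

text \<open>The quotient of the transforms at \<open>l\<close> and at \<open>c * l\<close> is the
  transform of the remainder law \<open>N\<close>, so its logarithm is convex as well.\<close>

lemma SD0_Rplus_ln_laplace_tr_convex:
  assumes M: "SD0_Rplus M"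
  shows "convex_on {0..} (\<lambda>l. ln (laplace_tr M l))"
    and "0 < c \<Longrightarrow> c < 1 \<Longrightarrow> convex_on {0..} (\<lambda>l. ln (laplace_tr M l) - ln (laplace_tr M (c * l)))"
proof -
  have nM: "nonneg_distr M" using M by (simp add: SD0_Rplus_def)
  show "convex_on {0..} (\<lambda>l. ln (laplace_tr M l))"
    by (rule ln_laplace_tr_convex) (use nM in \<open>auto dest: nonneg_distr_D integrable_laplace\<close>)
  assume c: "0 < c" "c < 1"
  then obtain N where N: "prob_space N" "sets N = sets borel"
      "M = (distr M borel (\<lambda>x. c * x) \<star> N)"
    using M by (auto simp: SD0_Rplus_def selfdecomposable_def)
  define Mc where "Mc = distr M borel (\<lambda>x. c * x)"
  have nMc: "nonneg_distr Mc" unfolding Mc_def using c nM by (intro nonneg_distr_scale) auto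
  interpret N: prob_space N by fact
  interpret Mc: prob_space Mc using nMc by (rule nonneg_distr_D)
  note [measurable_cong] = N(2) nonneg_distr_D(2)[OF nMc]
  have *: "integrable N (\<lambda>x. exp (- l * x)) \<and> laplace_tr M l = laplace_tr M (c * l) * laplace_tr N l"
    if l: "0 \<le> l" for l
  proof -
    have "ennreal (laplace_tr M l) = (\<integral>\<^sup>+x. ennreal (exp (- l * x)) \<partial>(Mc \<star> N))"
      using nn_integral_laplace[OF nM l] N(3) by (simp add: Mc_def)
    also have "\<dots> = (\<integral>\<^sup>+x. \<integral>\<^sup>+y. ennreal (exp (- l * (x + y))) \<partial>N \<partial>Mc)"
      by (rule nn_integral_convolution)
         (simp_all add: Mc.finite_measure_axioms N.finite_measure_axioms N nonneg_distr_D[OF nMc])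
    also have "\<dots> = (\<integral>\<^sup>+x. ennreal (exp (- l * x)) * (\<integral>\<^sup>+y. ennreal (exp (- l * y)) \<partial>N) \<partial>Mc)"
      by (rule nn_integral_cong)
         (simp add: distrib_left exp_add exp_diff divide_inverse exp_minus ennreal_mult nn_integral_cmult
            flip: exp_minus minus_mult_left)
    also have "\<dots> = ennreal (laplace_tr Mc l) * (\<integral>\<^sup>+y. ennreal (exp (- l * y)) \<partial>N)"
      by (subst nn_integral_multc) (auto simp: nn_integral_laplace[OF nMc l, simplified])
    finally have eq: "ennreal (laplace_tr M l) = ennreal (laplace_tr Mc l) * (\<integral>\<^sup>+y. ennreal (exp (- l * y)) \<partial>N)" .
    \<comment> \<open>A positive number times the transform of \<open>N\<close> is finite, hence so
      is the transform of \<open>N\<close>, although \<open>N\<close> may a priori charge the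
      negative axis.\<close>
    have pos: "0 < laplace_tr Mc l" using nMc l by (rule laplace_tr_pos)
    have "(\<integral>\<^sup>+y. ennreal (exp (- l * y)) \<partial>N) < \<infinity>"
    proof (rule ccontr)
      assume "\<not> ?thesis"
      then have "ennreal (laplace_tr M l) = \<infinity>"
        unfolding eq using pos by (simp add: ennreal_mult_eq_top_iff not_less top_unique)
      then show False by simp
    qed
    then have int: "integrable N (\<lambda>x. exp (- l * x))"
      by (intro integrableI_nonneg) auto
    then have "(\<integral>\<^sup>+y. ennreal (exp (- l * y)) \<partial>N) = ennreal (laplace_tr N l)"
      unfolding laplace_tr_def by (intro nn_integral_eq_integral) auto
    with eq have "laplace_tr M l = laplace_tr Mc l * laplace_tr N l"
      by (simp add: laplace_tr_nonneg flip: ennreal_mult)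
    with int show ?thesis
      using nonneg_distr_D(2)[OF nM] by (simp add: Mc_def laplace_tr_scale)
  qed
  have "convex_on {0..} (\<lambda>l. ln (laplace_tr N l))"
    by (rule ln_laplace_tr_convex) (use N * in auto)
  moreover have "ln (laplace_tr M l) - ln (laplace_tr M (c * l)) = ln (laplace_tr N l)" if "0 \<le> l" for l
  proof -
    have "0 < laplace_tr M (c * l)" "0 < laplace_tr M l"
      using nM that c by (auto intro!: laplace_tr_pos)
    then show ?thesis using * that by (simp add: ln_mult zero_less_mult_iff)
  qed
  ultimately show "convex_on {0..} (\<lambda>l. ln (laplace_tr M l) - ln (laplace_tr M (c * l)))"
    by (rule convex_on_eq_on) simp
qed

section \<open>Uniqueness of the law with a given Laplace transform\<close>

text \<open>The transforms at natural numbers are the moments of \<open>exp (- x)\<close>, which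
  takes values in the unit interval. Bernstein polynomials pass from moments to continuous
  functions, and ramps pass from these to distribution functions.\<close>

lemma nonneg_distr_eqI:
  assumes M: "nonneg_distr M" and N: "nonneg_distr N"
    and eq: "\<And>l. 0 \<le> l \<Longrightarrow> laplace_tr M l = laplace_tr N l"
  shows "M = N"
proof (rule cdf_unique)
  interpret M: prob_space M using M by (rule nonneg_distr_D)
  interpret N: prob_space N using N by (rule nonneg_distr_D)
  note [measurable_cong] = nonneg_distr_D(2)[OF M] nonneg_distr_D(2)[OF N]
  show rM: "real_distribution M" and rN: "real_distribution N"
    using nonneg_distr_D[OF M] nonneg_distr_D[OF N]
    by (auto intro!: real_distribution.intro real_distribution_axioms.intro)
  \<comment> \<open>Clipping at 0 changes nothing almost everywhere and keeps \<open>?y\<close> in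
    the unit interval at every point.\<close>
  let ?y = "\<lambda>x::real. exp (- max 0 x)"
  have y: "0 \<le> ?y x" "?y x \<le> 1" for x by auto
  have bM: "integrable M f" and bN: "integrable N f"
    if [measurable]: "f \<in> borel_measurable borel" and "\<And>x. norm (f x) \<le> B" for f :: "real \<Rightarrow> real" and B
    using that by (auto intro!: M.integrable_const_bound[where B = B] N.integrable_const_bound[where B = B])
  have power_le: "norm (?y x ^ i * (1 - ?y x) ^ j) \<le> 1" for x i j
    using y[of x] by (auto simp: abs_mult power_abs intro!: mult_le_one power_le_one)
  have ipow: "integrable M (\<lambda>x. ?y x ^ i * (1 - ?y x) ^ j)" "integrable N (\<lambda>x. ?y x ^ i * (1 - ?y x) ^ j)" for i j
    by (intro bM[OF _ power_le] bN[OF _ power_le]; measurable)+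
  \<comment> \<open>Bernstein monomials reduce to pure powers through
    \<open>(1 - y) ^ Suc j = (1 - y) ^ j - y * (1 - y) ^ j\<close>, which is why \<open>i\<close>
    varies in the induction. Pure powers are transforms at natural numbers.\<close>
  have mono: "(\<integral>x. ?y x ^ i * (1 - ?y x) ^ j \<partial>M) = (\<integral>x. ?y x ^ i * (1 - ?y x) ^ j \<partial>N)" for i j
  proof (induction j arbitrary: i)
    case 0
    have "(\<integral>x. ?y x ^ i \<partial>K) = laplace_tr K (real i)" if K: "nonneg_distr K" for K
    proof -
      note [measurable_cong] = nonneg_distr_D(2)[OF K]
      have "AE x in K. ?y x ^ i = exp (- real i * x)"
        using nonneg_distr_D(3)[OF K]
        by eventually_elim (simp flip: exp_of_nat_mult)
      then show ?thesis
        unfolding laplace_tr_def by (intro integral_cong_AE) auto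
    qed
    with M N show ?case using eq by simp
  next
    case (Suc j)
    have *: "?y x ^ i * (1 - ?y x) ^ Suc j = ?y x ^ i * (1 - ?y x) ^ j - ?y x ^ Suc i * (1 - ?y x) ^ j" for x
      by (simp add: algebra_simps)
    show ?case
      unfolding * using power_le Suc.IH
      by (subst (1 2) Bochner_Integration.integral_diff) (auto intro!: bM bN simp del: power_Suc)
  qed
  have cont: "(\<integral>x. g (?y x) \<partial>M) = (\<integral>x. g (?y x) \<partial>N)"
    if g: "continuous_on UNIV g" for g :: "real \<Rightarrow> real"
  proof -
    have [measurable]: "g \<in> borel_measurable borel" using g by (rule borel_measurable_continuous_onI)
    have g01: "continuous_on {0..1} g" using g by (rule continuous_on_subset) auto
    obtain B where B: "\<And>y. y \<in> {0..1} \<Longrightarrow> norm (g y) \<le> B"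
      using compact_imp_bounded[OF compact_continuous_image[OF g01]] by (force simp: bounded_iff)
    have "\<bar>(\<integral>x. g (?y x) \<partial>M) - (\<integral>x. g (?y x) \<partial>N)\<bar> \<le> e" if "0 < e" for e
    proof -
      obtain n where n: "\<And>y. y \<in> {0..1} \<Longrightarrow> \<bar>g y - (\<Sum>k\<le>n. g (k / n) * Bernstein n k y)\<bar> < e / 2"
        using Bernstein_Weierstrass[OF g01, of "e/2"] \<open>0 < e\<close> by auto
      define p where "p x = (\<Sum>k\<le>n. g (k / n) * (real (n choose k) * (?y x ^ k * (1 - ?y x) ^ (n - k))))" for x
      have p: "\<bar>g (?y x) - p x\<bar> \<le> e / 2" for x
        using n[of "?y x"] y[of x] by (auto simp: p_def Bernstein_def mult.assoc)
      have [measurable]: "p \<in> borel_measurable borel" unfolding p_def by measurable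
      have gB: "norm (g (?y x)) \<le> B" for x by (rule B) simp
      have pB: "norm (p x) \<le> B + e / 2" for x
        using gB[of x] p[of x] unfolding real_norm_def by linarith
      have ip: "integrable M p" "integrable N p"
        by (intro bM[OF _ pB] bN[OF _ pB]; measurable)+
      have ig: "integrable M (\<lambda>x. g (?y x))" "integrable N (\<lambda>x. g (?y x))"
        by (intro bM[OF _ gB] bN[OF _ gB]; measurable)+
      have "(\<integral>x. p x \<partial>M) = (\<integral>x. p x \<partial>N)"
        unfolding p_def
        by (subst (1 2) Bochner_Integration.integral_sum)
           (simp_all only: integral_mult_right_zero mono integrable_mult_right ipow)
      moreover have "\<bar>(\<integral>x. g (?y x) - p x \<partial>M)\<bar> \<le> (\<integral>x. e / 2 \<partial>M)"
        using ip ig p by (intro order_trans[OF integral_abs_bound integral_mono]) auto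
      moreover have "\<bar>(\<integral>x. g (?y x) - p x \<partial>N)\<bar> \<le> (\<integral>x. e / 2 \<partial>N)"
        using ip ig p by (intro order_trans[OF integral_abs_bound integral_mono]) auto
      moreover have "(\<integral>x. g (?y x) - p x \<partial>M) = (\<integral>x. g (?y x) \<partial>M) - (\<integral>x. p x \<partial>M)"
        "(\<integral>x. g (?y x) - p x \<partial>N) = (\<integral>x. g (?y x) \<partial>N) - (\<integral>x. p x \<partial>N)"
        using ip ig by simp_all
      moreover have "(\<integral>x. e / 2 \<partial>M) = e / 2" "(\<integral>x. e / 2 \<partial>N) = e / 2"
        by (simp_all add: M.prob_space N.prob_space)
      ultimately show ?thesis by linarith
    qed
    then have "\<bar>(\<integral>x. g (?y x) \<partial>M) - (\<integral>x. g (?y x) \<partial>N)\<bar> \<le> 0"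
      by (metis add_0 field_le_epsilon)
    then show ?thesis by simp
  qed
  show "cdf M = cdf N"
  proof
    fix a :: real
    show "cdf M a = cdf N a"
    proof (cases "0 \<le> a")
      case False
      have "measure K {..a} = 0" if K: "nonneg_distr K" for K
      proof -
        interpret K: prob_space K using K by (rule nonneg_distr_D)
        have "AE x in K. x \<notin> {..a}"
          using nonneg_distr_D(3)[OF K] by eventually_elim (use False in auto)
        then show ?thesis
          using nonneg_distr_D(2)[OF K] by (subst K.prob_eq_0) auto
      qed
      with M N show ?thesis by (simp add: cdf_def)
    next
      case True
      \<comment> \<open>For \<open>n > 0\<close> a ramp that is 1 when \<open>y\<close> is at least
        \<open>exp (- a)\<close> and 0 when \<open>y\<close> is at most
        \<open>exp (- a) - 1 / n\<close>. Since \<open>0 \<le> a\<close>, its composition with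
        \<open>?y\<close> tends to the indicator of \<open>{..a}\<close>.\<close>
      define g where "g n y = min 1 (max 0 (1 + real n * (y - exp (- a))))" for n y
      have gc: "continuous_on UNIV (g n)" for n unfolding g_def by (intro continuous_intros)
      have lim: "(\<lambda>n. g n (?y x)) \<longlonglongrightarrow> indicator {..a} x" for x
      proof (cases "x \<le> a")
        case x: True
        have "exp (- a) \<le> ?y x" using x True by auto
        then have "g n (?y x) = 1" for n unfolding g_def by auto
        with x show ?thesis by simp
      next
        case False
        then have "0 < exp (- a) - ?y x" using True by auto
        then obtain N where N: "1 < real N * (exp (- a) - ?y x)"
          using reals_Archimedean3[of "exp (- a) - ?y x"] by metis
        have "g n (?y x) = 0" if "N \<le> n" for n
        proof -
          have "real N * (exp (- a) - ?y x) \<le> real n * (exp (- a) - ?y x)"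
            using that \<open>0 < exp (- a) - ?y x\<close> by (intro mult_right_mono) auto
          then have "1 + real n * (?y x - exp (- a)) \<le> 0" using N by (simp add: algebra_simps)
          then show ?thesis by (simp add: g_def)
        qed
        then have "(\<lambda>n. g n (?y x)) \<longlonglongrightarrow> 0"
          by (intro tendsto_eventually) (auto simp: eventually_sequentially)
        with False show ?thesis by simp
      qed
      have [measurable]: "g n \<in> borel_measurable borel" for n
        using gc by (rule borel_measurable_continuous_onI)
      have gb: "norm (g n y) \<le> 1" for n y by (auto simp: g_def)
      have "(\<lambda>n. \<integral>x. g n (?y x) \<partial>M) \<longlonglongrightarrow> (\<integral>x. indicator {..a} x \<partial>M)"
        by (rule integral_dominated_convergence[where w = "\<lambda>_. 1"]) (use lim gb in auto)
      moreover have "(\<lambda>n. \<integral>x. g n (?y x) \<partial>N) \<longlonglongrightarrow> (\<integral>x. indicator {..a} x \<partial>N)"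
        by (rule integral_dominated_convergence[where w = "\<lambda>_. 1"]) (use lim gb in auto)
      ultimately have "(\<integral>x. indicator {..a} x \<partial>M) = (\<integral>x. indicator {..a} x \<partial>N :: real)"
        unfolding cont[OF gc] by (rule LIMSEQ_unique)
      then show ?thesis by (simp add: cdf_def nonneg_distr_D[OF M] nonneg_distr_D[OF N])
    qed
  qed
qed

section \<open>Laws with a given Levy density\<close>

text \<open>Tightness yields a weak limit along a subsequence, and its transform has to be
  \<open>\<phi>\<close>. The bound \<open>lower\<close> makes tightness uniform in \<open>n\<close>:
  one small \<open>l\<close> with \<open>\<phi> l\<close> near 1 controls all tails.\<close>

lemma laplace_tr_continuity:
  assumes M: "\<And>n. nonneg_distr (M n)"
    and lim: "\<And>l. 0 \<le> l \<Longrightarrow> (\<lambda>n. laplace_tr (M n) l) \<longlonglongrightarrow> \<phi> l"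
    and lower: "\<And>n l. 0 \<le> l \<Longrightarrow> \<phi> l \<le> laplace_tr (M n) l"
    and one: "(\<phi> \<longlongrightarrow> 1) (at_right 0)"
  shows "\<exists>N. nonneg_distr N \<and> (\<forall>l\<ge>0. laplace_tr N l = \<phi> l)"
proof -
  have rM: "real_distribution (M n)" for n
    using nonneg_distr_D[OF M, of n] by (auto intro!: real_distribution.intro real_distribution_axioms.intro)
  interpret M: real_distribution "M n" for n by (rule rM)
  have "tight M"
    unfolding tight_def
  proof (intro conjI allI impI rM)
    fix e :: real assume "0 < e"
    \<comment> \<open>On the half-line \<open>exp (- l * x)\<close> is at most
      \<open>indicator {-1<..1 / l} x * ?d + exp (- 1)\<close>, a Markov-type bound. The left end -1
      keeps a possible atom at 0 inside the half-open interval.\<close>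
    let ?d = "1 - exp (-1 :: real)"
    have d: "0 < ?d" by simp
    have "\<forall>\<^sub>F l in at_right 0. 1 - e * ?d < \<phi> l"
      using one \<open>0 < e\<close> d by (intro order_tendstoD) auto
    moreover have "\<forall>\<^sub>F l::real in at_right 0. 0 < l" by (rule eventually_at_right_less)
    ultimately have "\<forall>\<^sub>F l in at_right 0. 1 - e * ?d < \<phi> l \<and> 0 < l"
      by (rule eventually_conj)
    then obtain l where l: "1 - e * ?d < \<phi> l" "0 < l"
      using eventually_happens'[OF trivial_limit_at_right_real] by blast
    have "1 - e < measure (M n) {-1<..1 / l}" for n
    proof -
      have int: "integrable (M n) (\<lambda>x. exp (- l * x))"
        using M l by (intro integrable_laplace) auto
      have "laplace_tr (M n) l \<le> (\<integral>x. indicator {-1<..1 / l} x * ?d + exp (- 1) \<partial>M n)"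
        unfolding laplace_tr_def
      proof (rule integral_mono_AE)
        show "AE x in M n. exp (- l * x) \<le> indicator {-1<..1 / l} x * ?d + exp (- 1)"
          using nonneg_distr_D(3)[OF M, of n]
        proof eventually_elim
          case (elim x)
          then have "x \<notin> {-1<..1 / l} \<Longrightarrow> 1 \<le> l * x" using l by (auto simp: field_simps)
          then show ?case using elim l by (auto split: split_indicator)
        qed
      qed (use int in \<open>auto intro!: integrable_add integrable_mult_left M.integrable_const_bound[where B = 1] split: split_indicator\<close>)
      also have "\<dots> = measure (M n) {-1<..1 / l} * ?d + exp (- 1)"
        by (subst Bochner_Integration.integral_add)
           (auto intro!: integrable_mult_left M.integrable_const_bound[where B = 1] simp: M.prob_space[simplified] split: split_indicator)
      finally have "1 - e * ?d < measure (M n) {-1<..1 / l} * ?d + exp (- 1)"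
        using l lower[of l n] by linarith
      then have "(1 - e) * ?d < measure (M n) {-1<..1 / l} * ?d"
        by (simp add: left_diff_distrib)
      then show ?thesis using d by (simp only: mult_less_cancel_right_pos)
    qed
    moreover have "-1 < 1 / l" using l by (simp add: less_trans[of _ 0])
    ultimately show "\<exists>a b. a < b \<and> (\<forall>n. 1 - e < measure (M n) {a<..b})" by blast
  qed
  from tight_imp_convergent_subsubsequence[OF this strict_mono_id] obtain r N
    where r: "strict_mono r" and N: "real_distribution N" and w: "weak_conv_m (M \<circ> r) N"
    by (auto simp: id_def comp_def)
  interpret N: real_distribution N by (rule N)
  have conv: "(\<lambda>n. \<integral>x. f x \<partial>M (r n)) \<longlonglongrightarrow> (\<integral>x. f x \<partial>N)"
    if "\<And>x. isCont f x" "\<And>x. norm (f x) \<le> B" for f :: "real \<Rightarrow> real" and B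
    using weak_conv_imp_integral_bdd_continuous_conv[of "M \<circ> r" N f B] that w rM N by (simp add: comp_def)
  \<comment> \<open>This bounded continuous function vanishes exactly on the half-line, so its
    integral detects any negative mass of the limit.\<close>
  have "(\<lambda>n. \<integral>x. min 1 (max 0 (- x)) \<partial>M (r n)) \<longlonglongrightarrow> (\<integral>x. min 1 (max 0 (- x)) \<partial>N)"
    by (rule conv[of _ 1]) (auto intro!: continuous_intros)
  moreover have "(\<integral>x. min 1 (max 0 (- x)) \<partial>M n) = 0" for n
    by (rule integral_eq_zero_AE) (use nonneg_distr_D(3)[OF M, of n] in \<open>eventually_elim, auto\<close>)
  ultimately have "(\<integral>x. min 1 (max 0 (- x)) \<partial>N) = (0::real)"
    by (simp add: LIMSEQ_const_iff)
  then have "AE x in N. min 1 (max 0 (- x)) = (0::real)"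
    by (subst (asm) integral_nonneg_eq_0_iff_AE) (auto intro!: N.integrable_const_bound[where B = 1])
  then have posN: "AE x in N. 0 \<le> x" by eventually_elim (auto simp: min_def max_def split: if_splits)
  then have nN: "nonneg_distr N"
    by (simp add: nonneg_distr_def N.prob_space_axioms)
  moreover have "laplace_tr N l = \<phi> l" if l: "0 \<le> l" for l
  proof -
    \<comment> \<open>The clipped exponential is bounded and continuous on the whole line, as weak
      convergence requires.\<close>
    let ?f = "\<lambda>x. exp (- l * max 0 x)"
    have "(\<lambda>n. \<integral>x. ?f x \<partial>M (r n)) \<longlonglongrightarrow> (\<integral>x. ?f x \<partial>N)"
      by (rule conv[of _ 1]) (use l in \<open>auto intro!: continuous_intros\<close>)
    moreover have "(\<integral>x. ?f x \<partial>K) = laplace_tr K l" if K: "nonneg_distr K" for K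
    proof -
      note [measurable_cong] = nonneg_distr_D(2)[OF K]
      have "AE x in K. ?f x = exp (- l * x)"
        using nonneg_distr_D(3)[OF K] by eventually_elim simp
      then show ?thesis
        unfolding laplace_tr_def by (intro integral_cong_AE) auto
    qed
    ultimately have "(\<lambda>n. laplace_tr (M (r n)) l) \<longlonglongrightarrow> laplace_tr N l"
      using nN M by simp
    moreover have "(\<lambda>n. laplace_tr (M (r n)) l) \<longlonglongrightarrow> \<phi> l"
      using LIMSEQ_subseq_LIMSEQ[OF lim[OF l] r] by (simp add: comp_def)
    ultimately show ?thesis by (rule LIMSEQ_unique)
  qed
  ultimately show ?thesis by blast
qed

section \<open>Compound Poisson laws and their limits\<close>

primrec convolution_power :: "real measure \<Rightarrow> nat \<Rightarrow> real measure" where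
  "convolution_power M 0 = return borel 0"
| "convolution_power M (Suc n) = (M \<star> convolution_power M n)"

lemma convolution_power:
  assumes "nonneg_distr M"
  shows nonneg_distr_convolution_power: "nonneg_distr (convolution_power M n)"
    and laplace_tr_convolution_power: "0 \<le> l \<Longrightarrow> laplace_tr (convolution_power M n) l = laplace_tr M l ^ n"
  using assms by (induction n)
    (auto simp: nonneg_distr_return laplace_tr_return nonneg_distr_convolution laplace_tr_convolution)

text \<open>A Poisson mixture of the convolution powers: the transforms \<open>?a ^ n\<close>,
  weighted by the Poisson probabilities, add up to an exponential series.\<close>

lemma compound_Poisson:
  assumes M: "nonneg_distr M" and m: "0 < m"
  shows "\<exists>N. nonneg_distr N \<and> (\<forall>l\<ge>0. laplace_tr N l = exp (- m * (1 - laplace_tr M l)))"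
proof -
  let ?P = "measure_pmf (poisson_pmf m)"
  define N where "N = ?P \<bind> convolution_power M"
  note c = nonneg_distr_convolution_power[OF M]
  have meas: "convolution_power M \<in> measurable ?P (subprob_algebra borel)"
    using nonneg_distr_D[OF c] by (auto simp: space_subprob_algebra intro: prob_space_imp_subprob_space)
  have sets: "sets N = sets borel"
    unfolding N_def by (rule sets_bind) (auto simp: nonneg_distr_D[OF c])
  have "prob_space N"
    unfolding N_def by (rule measure_pmf.prob_space_bind[OF _ meas])
      (auto simp: nonneg_distr_D[OF c])
  moreover have "AE x in N. 0 \<le> x"
    unfolding N_def by (subst AE_bind[OF meas]) (auto simp: nonneg_distr_D[OF c])
  ultimately have "nonneg_distr N" using sets by (simp add: nonneg_distr_def)
  moreover have "laplace_tr N l = exp (- m * (1 - laplace_tr M l))" if l: "0 \<le> l" for l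
  proof (rule laplace_trI)
    let ?a = "laplace_tr M l"
    have a: "0 \<le> ?a" by (rule laplace_tr_nonneg)
    have "(\<lambda>n. (m * ?a) ^ n /\<^sub>R fact n) sums exp (m * ?a)" by (rule exp_converges)
    from sums_mult[OF this, of "exp (- m)"]
    have sums: "(\<lambda>n. m ^ n / fact n * exp (- m) * ?a ^ n) sums exp (- m * (1 - ?a))"
      by (simp add: power_mult_distrib field_simps flip: exp_add)
    have "(\<integral>\<^sup>+x. ennreal (exp (- l * x)) \<partial>N)
        = (\<integral>\<^sup>+n. \<integral>\<^sup>+x. ennreal (exp (- l * x)) \<partial>convolution_power M n \<partial>?P)"
      unfolding N_def by (rule nn_integral_bind[OF _ meas]) auto
    also have "\<dots> = (\<integral>\<^sup>+n. ennreal (?a ^ n) \<partial>?P)"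
      by (rule nn_integral_cong)
         (simp only: nn_integral_laplace[OF c l] laplace_tr_convolution_power[OF M l])
    also have "\<dots> = (\<Sum>n. ennreal (m ^ n / fact n * exp (- m) * ?a ^ n))"
      using m a by (simp add: nn_integral_measure_pmf nn_integral_count_space_nat flip: ennreal_mult)
    also have "\<dots> = ennreal (exp (- m * (1 - ?a)))"
      using m a sums by (intro suminf_ennreal_eq) auto
    finally show "(\<integral>\<^sup>+x. ennreal (exp (- l * x)) \<partial>N) = ennreal (exp (- m * (1 - ?a)))" .
  qed (use sets in auto)
  ultimately show ?thesis by blast
qed

text \<open>Dividing \<open>w\<close> by its total mass \<open>m\<close> gives a jump law, and the
  compound Poisson law with rate \<open>m\<close> has Levy density \<open>w\<close>. Zero mass gives
  the point mass at 0.\<close>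

lemma finite_Levy_density:
  fixes w :: "real \<Rightarrow> real"
  assumes w0: "\<And>x. 0 \<le> w x" "\<And>x. x \<le> 0 \<Longrightarrow> w x = 0" and int: "integrable lborel w"
  shows "\<exists>N. nonneg_distr N \<and> (\<forall>l\<ge>0. laplace_tr N l = exp (- (\<integral>x. (1 - exp (- l * x)) * w x \<partial>lborel)))"
proof (cases "(\<integral>x. w x \<partial>lborel) = 0")
  case True
  then have "AE x in lborel. w x = 0"
    using int w0 by (subst (asm) integral_nonneg_eq_0_iff_AE) auto
  then have "AE x in lborel. (1 - exp (- l * x)) * w x = 0" for l
    by eventually_elim simp
  then have "(\<integral>x. (1 - exp (- l * x)) * w x \<partial>lborel) = 0" for l
    by (rule integral_eq_zero_AE)
  then show ?thesis
    by (intro exI[of _ "return borel 0"]) (simp add: nonneg_distr_return laplace_tr_return)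
next
  case False
  define m where "m = (\<integral>x. w x \<partial>lborel)"
  have m: "0 < m" using False w0 Bochner_Integration.integral_nonneg[of lborel w] by (simp add: m_def less_le)
  have [measurable]: "w \<in> borel_measurable borel" using borel_measurable_integrable[OF int] by simp
  define \<mu> where "\<mu> = density lborel (\<lambda>x. ennreal (w x / m))"
  have "(\<integral>\<^sup>+x. ennreal (w x / m) \<partial>lborel) = ennreal (\<integral>x. w x / m \<partial>lborel)"
    using int w0 m by (intro nn_integral_eq_integral) auto
  also have "\<dots> = 1" using m by (simp add: m_def)
  finally have "prob_space \<mu>"
    by (auto intro!: prob_spaceI simp: \<mu>_def emeasure_density)
  moreover have "AE x in \<mu>. 0 \<le> x"
    unfolding \<mu>_def using w0(2) by (subst AE_density) (auto intro!: AE_I2 elim: contrapos_pp simp: not_le)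
  moreover have "sets \<mu> = sets borel" by (simp add: \<mu>_def)
  ultimately have \<mu>: "nonneg_distr \<mu>" by (simp add: nonneg_distr_def)
  from compound_Poisson[OF this m] obtain N where N: "nonneg_distr N"
    "\<And>l. 0 \<le> l \<Longrightarrow> laplace_tr N l = exp (- m * (1 - laplace_tr \<mu> l))" by blast
  have "m * (1 - laplace_tr \<mu> l) = (\<integral>x. (1 - exp (- l * x)) * w x \<partial>lborel)" if l: "0 \<le> l" for l
  proof -
    have ew: "integrable lborel (\<lambda>x. exp (- l * x) * w x)"
    proof (rule Bochner_Integration.integrable_bound[OF int])
      show "AE x in lborel. norm (exp (- l * x) * w x) \<le> norm (w x)"
      proof (rule AE_I2)
        fix x show "norm (exp (- l * x) * w x) \<le> norm (w x)"
          using w0 l by (cases "0 < x") (auto simp: abs_mult intro!: mult_left_le_one_le)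
      qed
    qed simp
    have "laplace_tr \<mu> l = (\<integral>x. w x / m * exp (- l * x) \<partial>lborel)"
      unfolding laplace_tr_def \<mu>_def using w0 m by (subst integral_density) auto
    also have "\<dots> = (\<integral>x. (exp (- l * x) * w x) / m \<partial>lborel)"
      by (simp add: ac_simps)
    finally have "m * laplace_tr \<mu> l = (\<integral>x. exp (- l * x) * w x \<partial>lborel)" using m by simp
    then have "m * (1 - laplace_tr \<mu> l) = (\<integral>x. w x \<partial>lborel) - (\<integral>x. exp (- l * x) * w x \<partial>lborel)"
      by (simp add: right_diff_distrib m_def)
    also have "\<dots> = (\<integral>x. w x - exp (- l * x) * w x \<partial>lborel)"
      using int ew by simp
    finally show ?thesis by (simp add: left_diff_distrib)
  qed
  with N show ?thesis by auto
qed

text \<open>Cutting \<open>w\<close> off below \<open>1 / Suc n\<close> leaves a finite Levy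
  measure. The truncated exponents stay below the full one and converge to it, so
  \<open>laplace_tr_continuity\<close> applies.\<close>

lemma Levy_density:
  fixes w :: "real \<Rightarrow> real"
  assumes w0: "\<And>x. 0 \<le> w x" "\<And>x. x \<le> 0 \<Longrightarrow> w x = 0" and [measurable]: "w \<in> borel_measurable borel"
    and int: "\<And>l. 0 \<le> l \<Longrightarrow> integrable lborel (\<lambda>x. (1 - exp (- l * x)) * w x)"
  shows "\<exists>N. nonneg_distr N \<and> (\<forall>l\<ge>0. laplace_tr N l = exp (- (\<integral>x. (1 - exp (- l * x)) * w x \<partial>lborel)))"
proof -
  have pos: "0 \<le> (1 - exp (- l * x)) * w x" if "0 \<le> l" for l x
    using w0 that by (cases "0 < x") auto
  define v where "v n x = indicator {1 / real (Suc n)..} x * w x" for n x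
  have v0: "0 \<le> v n x" "x \<le> 0 \<Longrightarrow> v n x = 0" for n x
    using w0 by (auto simp: v_def)
  have vw: "(1 - exp (- l * x)) * v n x \<le> (1 - exp (- l * x)) * w x" if "0 \<le> l" for n x l
    using pos[OF that] by (auto simp: v_def split: split_indicator)
  have [measurable]: "v n \<in> borel_measurable borel" for n unfolding v_def by measurable
  have iv: "integrable lborel (v n)" for n
  proof (rule Bochner_Integration.integrable_bound)
    \<comment> \<open>The value of \<open>1 - exp (- x)\<close> at the cut-off, a lower bound
      wherever \<open>v n\<close> can be nonzero. Dividing by it turns the hypothesis at
      \<open>l = 1\<close> into integrability of \<open>v n\<close>.\<close>
    let ?C = "1 - exp (- (1 / real (Suc n)))"
    show "integrable lborel (\<lambda>x. (1 - exp (- 1 * x)) * w x / ?C)"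
      using int[of 1] by simp
    show "AE x in lborel. norm (v n x) \<le> norm ((1 - exp (- 1 * x)) * w x / ?C)"
    proof (rule AE_I2)
      fix x
      show "norm (v n x) \<le> norm ((1 - exp (- 1 * x)) * w x / ?C)"
      proof (cases "1 / real (Suc n) \<le> x")
        case True
        have C: "0 < ?C" by simp
        have "?C \<le> 1 - exp (- x)" using True by simp
        then have "?C * w x \<le> (1 - exp (- x)) * w x" using w0 by (intro mult_right_mono) auto
        then have "w x \<le> (1 - exp (- 1 * x)) * w x / ?C" using C by (simp add: pos_le_divide_eq mult.commute)
        moreover have "norm (v n x) = w x" using True w0 by (simp add: v_def)
        ultimately show ?thesis using pos[of 1 x] C by (simp add: abs_of_nonneg)
      qed (simp add: v_def)
    qed
  qed simp
  have "\<forall>n. \<exists>N. nonneg_distr N \<and> (\<forall>l\<ge>0. laplace_tr N l = exp (- (\<integral>x. (1 - exp (- l * x)) * v n x \<partial>lborel)))"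
    using finite_Levy_density[OF v0 iv] by blast
  then obtain M where M: "\<And>n. nonneg_distr (M n)"
    "\<And>n l. 0 \<le> l \<Longrightarrow> laplace_tr (M n) l = exp (- (\<integral>x. (1 - exp (- l * x)) * v n x \<partial>lborel))"
    by metis
  have iv': "integrable lborel (\<lambda>x. (1 - exp (- l * x)) * v n x)" if "0 \<le> l" for l n
  proof (rule Bochner_Integration.integrable_bound[OF int[OF that]])
    show "AE x in lborel. norm ((1 - exp (- l * x)) * v n x) \<le> norm ((1 - exp (- l * x)) * w x)"
      by (rule AE_I2) (auto simp: v_def split: split_indicator)
  qed simp
  show ?thesis
  proof (rule laplace_tr_continuity[OF M(1)])
    fix l :: real assume l: "0 \<le> l"
    have "(\<lambda>n. \<integral>x. (1 - exp (- l * x)) * v n x \<partial>lborel) \<longlonglongrightarrow> (\<integral>x. (1 - exp (- l * x)) * w x \<partial>lborel)"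
    proof (rule integral_dominated_convergence[OF _ _ int[OF l]])
      show "AE x in lborel. (\<lambda>n. (1 - exp (- l * x)) * v n x) \<longlonglongrightarrow> (1 - exp (- l * x)) * w x"
      proof (intro AE_I2 tendsto_mult tendsto_const)
        fix x
        show "(\<lambda>n. v n x) \<longlonglongrightarrow> w x"
        proof (cases "0 < x")
          case True
          then obtain n0 where n0: "1 / real (Suc n0) < x"
            using reals_Archimedean[of x] by (auto simp: inverse_eq_divide)
          have "v n x = w x" if "n0 \<le> n" for n
          proof -
            have "1 / real (Suc n) \<le> 1 / real (Suc n0)" using that by (intro divide_left_mono) auto
            with n0 show ?thesis by (simp add: v_def)
          qed
          then show ?thesis by (intro tendsto_eventually) (auto simp: eventually_sequentially)
        qed (use v0 w0 in auto)
      qed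
      show "AE x in lborel. norm ((1 - exp (- l * x)) * v n x) \<le> (1 - exp (- l * x)) * w x" for n
        using pos[OF l] by (intro AE_I2) (auto simp: v_def split: split_indicator)
    qed simp_all
    then show "(\<lambda>n. laplace_tr (M n) l) \<longlonglongrightarrow> exp (- (\<integral>x. (1 - exp (- l * x)) * w x \<partial>lborel))"
      unfolding M(2)[OF l] by (intro tendsto_intros)
    show "exp (- (\<integral>x. (1 - exp (- l * x)) * w x \<partial>lborel)) \<le> laplace_tr (M n) l" for n
      unfolding M(2)[OF l] using integral_mono[OF iv'[OF l] int[OF l] vw[OF l]] by simp
  next
    have "((\<lambda>l. \<integral>x. (1 - exp (- l * x)) * w x \<partial>lborel) \<longlongrightarrow> (\<integral>x. 0 \<partial>(lborel :: real measure))) (at_right 0)"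
    \<comment> \<open>Sequences below 1 suffice for the limit at 0, and for them the integrand at
      \<open>l = 1\<close> is a dominating function.\<close>
    proof (rule tendsto_at_right_sequentially[of 0 1])
      fix S :: "nat \<Rightarrow> real" assume S: "\<And>n. 0 < S n" "\<And>n. S n < 1" "S \<longlonglongrightarrow> 0"
      show "(\<lambda>n. \<integral>x. (1 - exp (- S n * x)) * w x \<partial>lborel) \<longlonglongrightarrow> (\<integral>x. 0 \<partial>(lborel :: real measure))"
      proof (rule integral_dominated_convergence[OF _ _ int[of 1]])
        show "AE x in lborel. (\<lambda>n. (1 - exp (- S n * x)) * w x) \<longlonglongrightarrow> 0"
          using S(3) by (intro AE_I2) (auto intro!: tendsto_eq_intros)
        show "AE x in lborel. norm ((1 - exp (- S n * x)) * w x) \<le> (1 - exp (- 1 * x)) * w x" for n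
        proof (rule AE_I2)
          fix x
          have "(1 - exp (- S n * x)) * w x \<le> (1 - exp (- 1 * x)) * w x"
          proof (cases "0 < x")
            case True
            then have "S n * x \<le> 1 * x" using S(2)[of n] by (intro mult_right_mono) auto
            then show ?thesis using w0 by (intro mult_right_mono) auto
          qed (use w0 in simp)
          then show "norm ((1 - exp (- S n * x)) * w x) \<le> (1 - exp (- 1 * x)) * w x"
            using pos[of "S n" x] S(1)[of n] by simp
        qed
      qed simp_all
    qed simp
    then have "((\<lambda>l. exp (- (\<integral>x. (1 - exp (- l * x)) * w x \<partial>lborel))) \<longlongrightarrow> exp (- 0)) (at_right 0)"
      by (intro tendsto_intros) simp
    then show "((\<lambda>l. exp (- (\<integral>x. (1 - exp (- l * x)) * w x \<partial>lborel))) \<longlongrightarrow> 1) (at_right 0)" by simp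
  qed
qed

text \<open>Scaling a variable by \<open>c\<close> turns its Levy density \<open>w x\<close> into
  \<open>w (x / c) / c\<close>. The difference \<open>v\<close> of the two is again a Levy density
  because \<open>k\<close> is nonincreasing, and it belongs to the remainder law.\<close>

lemma SD0_Rplus_of_antimono:
  fixes k :: "real \<Rightarrow> real"
  defines "w \<equiv> \<lambda>x. if 0 < x then k x / x else 0"
  assumes k0: "\<And>x. 0 < x \<Longrightarrow> 0 \<le> k x" and kmono: "\<And>x y. 0 < x \<Longrightarrow> x \<le> y \<Longrightarrow> k y \<le> k x"
    and [measurable]: "k \<in> borel_measurable borel"
    and int: "\<And>l. 0 \<le> l \<Longrightarrow> integrable lborel (\<lambda>x. (1 - exp (- l * x)) * w x)"
  shows "\<exists>M. SD0_Rplus M \<and> (\<forall>l\<ge>0. laplace_tr M l = exp (- (\<integral>x. (1 - exp (- l * x)) * w x \<partial>lborel)))"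
proof -
  let ?I = "\<lambda>w l. \<integral>x. (1 - exp (- l * x)) * w x \<partial>lborel"
  have w0: "0 \<le> w x" "x \<le> 0 \<Longrightarrow> w x = 0" for x using k0 by (auto simp: w_def)
  have [measurable]: "w \<in> borel_measurable borel" unfolding w_def by measurable
  obtain M where M: "nonneg_distr M" "\<And>l. 0 \<le> l \<Longrightarrow> laplace_tr M l = exp (- ?I w l)"
    using Levy_density[OF w0 _ int] by auto
  have "\<exists>N. prob_space N \<and> sets N = sets borel \<and> M = (distr M borel (\<lambda>x. c * x) \<star> N)"
    if c: "0 < c" "c < 1" for c
  proof -
    define v where "v x = w x - w (x / c) / c" for x
    have v0: "0 \<le> v x" "x \<le> 0 \<Longrightarrow> v x = 0" for x
    proof -
      show "0 \<le> v x"
      proof (cases "0 < x")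
        case True
        have "x \<le> x / c" using True c by (simp add: pos_le_divide_eq mult_left_le)
        with True c show ?thesis
          using kmono[of x "x / c"] by (simp add: v_def w_def divide_right_mono)
      qed (use c in \<open>auto simp: v_def w_def zero_less_divide_iff\<close>)
      show "x \<le> 0 \<Longrightarrow> v x = 0"
        using c by (auto simp: v_def w_def zero_less_divide_iff)
    qed
    have [measurable]: "v \<in> borel_measurable borel" unfolding v_def by measurable
    have *: "integrable lborel (\<lambda>x. (1 - exp (- l * x)) * (w (x / c) / c))"
      "(\<integral>x. (1 - exp (- l * x)) * (w (x / c) / c) \<partial>lborel) = ?I w (c * l)" if l: "0 \<le> l" for l
    proof -
      have cl: "0 \<le> c * l" using c l by simp
      have eq: "(1 - exp (- l * x)) * (w (x / c) / c)
          = (1 - exp (- (c * l) * (0 + (1 / c) * x))) * w (0 + (1 / c) * x) / c" for x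
        using c by simp
      show "integrable lborel (\<lambda>x. (1 - exp (- l * x)) * (w (x / c) / c))"
        unfolding eq using lborel_integrable_real_affine[OF int[OF cl], of "1 / c" 0] c by simp
      show "(\<integral>x. (1 - exp (- l * x)) * (w (x / c) / c) \<partial>lborel) = ?I w (c * l)"
        unfolding eq
        using c by (subst lborel_integral_real_affine[of "1 / c" _ 0, where f = "\<lambda>x. (1 - exp (- (c * l) * x)) * w x"]) simp_all
    qed
    have iv: "integrable lborel (\<lambda>x. (1 - exp (- l * x)) * v x)"
      "?I v l = ?I w l - ?I w (c * l)" if l: "0 \<le> l" for l
    proof -
      have eq: "(1 - exp (- l * x)) * v x = (1 - exp (- l * x)) * w x - (1 - exp (- l * x)) * (w (x / c) / c)" for x
        by (simp add: v_def right_diff_distrib)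
      show "integrable lborel (\<lambda>x. (1 - exp (- l * x)) * v x)"
        unfolding eq by (intro Bochner_Integration.integrable_diff int * l)
      show "?I v l = ?I w l - ?I w (c * l)"
        unfolding eq by (subst Bochner_Integration.integral_diff[OF int[OF l] *(1)[OF l]]) (simp only: *(2)[OF l])
    qed
    obtain N where N: "nonneg_distr N" "\<And>l. 0 \<le> l \<Longrightarrow> laplace_tr N l = exp (- ?I v l)"
      using Levy_density[OF v0 _ iv(1)] by auto
    have Mc: "nonneg_distr (distr M borel (\<lambda>x. c * x))" using M c by (intro nonneg_distr_scale) auto
    have "M = (distr M borel (\<lambda>x. c * x) \<star> N)"
    proof (rule nonneg_distr_eqI[OF M(1) nonneg_distr_convolution[OF Mc N(1)]])
      fix l :: real assume l: "0 \<le> l"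
      then have cl: "0 \<le> c * l" using c by simp
      show "laplace_tr M l = laplace_tr (distr M borel (\<lambda>x. c * x) \<star> N) l"
        unfolding laplace_tr_convolution[OF Mc N(1) l] laplace_tr_scale[OF nonneg_distr_D(2)[OF M(1)]]
          M(2)[OF l] M(2)[OF cl] N(2)[OF l] iv(2)[OF l]
        by (simp flip: exp_add)
    qed
    with N show ?thesis by (auto dest: nonneg_distr_D)
  qed
  then have "SD0_Rplus M" using M by (auto simp: SD0_Rplus_def selfdecomposable_def)
  with M show ?thesis by auto
qed

section \<open>Convexity of the Bernoulli generating function\<close>

text \<open>This is \<open>3 * sinh x \<le> x * (2 + cosh x)\<close>. \<open>F1\<close> and
  \<open>F2\<close> are the first two derivatives of \<open>F\<close>; all three vanish at 0, and
  the derivative of \<open>F2\<close> is visibly nonnegative. The constant 1/12 that matches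
  \<open>t0\<close> originates here.\<close>

lemma exp_sum_ineq:
  fixes x :: real
  assumes "0 \<le> x"
  shows "3 * (exp x - exp (- x)) \<le> x * (exp x + 4 + exp (- x))"
proof -
  define F where "F x = x * (exp x + 4 + exp (- x)) - 3 * (exp x - exp (- x))" for x :: real
  define F1 where "F1 x = 4 - 2 * (exp x + exp (- x)) + x * (exp x - exp (- x))" for x :: real
  define F2 where "F2 x = x * (exp x + exp (- x)) - (exp x - exp (- x))" for x :: real
  have d2: "(F2 has_real_derivative x * (exp x - exp (- x))) (at x)" for x
    unfolding F2_def by (auto intro!: derivative_eq_intros simp: algebra_simps)
  have d1: "(F1 has_real_derivative F2 x) (at x)" for x
    unfolding F1_def F2_def by (auto intro!: derivative_eq_intros simp: algebra_simps)
  have d: "(F has_real_derivative F1 x) (at x)" for x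
    unfolding F_def F1_def by (auto intro!: derivative_eq_intros simp: algebra_simps)
  have "F2 0 \<le> F2 x" if "0 \<le> x" for x
    by (rule DERIV_nonneg_imp_nondecreasing[OF that]) (use d2 in \<open>force intro!: mult_nonneg_nonneg\<close>)
  then have F2: "0 \<le> F2 x" if "0 \<le> x" for x using that by (simp add: F2_def)
  have "F1 0 \<le> F1 x" if "0 \<le> x" for x
    by (rule DERIV_nonneg_imp_nondecreasing[OF that]) (use d1 F2 in force)
  then have F1: "0 \<le> F1 x" if "0 \<le> x" for x using that by (simp add: F1_def)
  have "F 0 \<le> F x"
    by (rule DERIV_nonneg_imp_nondecreasing[OF assms]) (use d F1 in force)
  then show ?thesis by (simp add: F_def)
qed

text \<open>Equivalent to \<open>tanh (x / 2) \<le> x / 2\<close>; differentiation reduces it to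
  \<open>1 + y \<le> exp y\<close>.\<close>

lemma exp_minus_ineq:
  fixes x :: real
  assumes "0 \<le> x"
  shows "2 * (1 - exp (- x)) \<le> x * (1 + exp (- x))"
proof -
  define F where "F x = x * (1 + exp (- x)) - 2 * (1 - exp (- x))" for x :: real
  have "F 0 \<le> F x"
  proof (rule DERIV_nonneg_imp_nondecreasing[OF assms])
    fix y :: real assume "0 \<le> y"
    have "(F has_real_derivative 1 - (1 + y) * exp (- y)) (at y)"
      unfolding F_def by (auto intro!: derivative_eq_intros simp: algebra_simps)
    moreover have "(1 + y) * exp (- y) \<le> exp y * exp (- y)"
      by (intro mult_right_mono exp_ge_add_one_self) auto
    ultimately show "\<exists>z. (F has_real_derivative z) (at y) \<and> 0 \<le> z"
      by (auto simp flip: exp_add)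
  qed
  then show ?thesis by (simp add: F_def)
qed

text \<open>The exponential generating function of the Bernoulli polynomials at \<open>1 - t\<close>.\<close>
definition bern_gen :: "real \<Rightarrow> real \<Rightarrow> real" where
  "bern_gen t x = (if 0 < x then x * exp (- t * x) / (1 - exp (- x)) else 0)"

lemma bern_gen_nonneg: "0 \<le> bern_gen t x"
  by (simp add: bern_gen_def)

lemma bern_gen_measurable [measurable]: "bern_gen t \<in> borel_measurable borel"
  unfolding bern_gen_def by measurable

text \<open>Centred at 1/2, the polynomial \<open>t^2 - t + 1/6\<close> is
  \<open>(t - 1/2)^2 - 1/12\<close>, and \<open>t0\<close> is its larger root.\<close>

lemma t0_bounds:
  assumes "t0 \<le> t"
  shows "1 / 2 \<le> t" "1 / 12 \<le> (t - 1 / 2)\<^sup>2"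
proof -
  have *: "1 / (2 * sqrt 3) \<le> t - 1 / 2" using assms by (simp add: t0_def)
  moreover have "0 \<le> 1 / (2 * sqrt 3)" by simp
  ultimately show "1 / 2 \<le> t" by linarith
  have "(1 / (2 * sqrt 3))\<^sup>2 \<le> (t - 1 / 2)\<^sup>2" using * by (intro power_mono) auto
  then show "1 / 12 \<le> (t - 1 / 2)\<^sup>2" by (simp add: power_divide power_mult_distrib)
qed

lemma t0_leI:
  assumes "1 / 2 \<le> t" "0 \<le> t\<^sup>2 - t + 1 / 6"
  shows "t0 \<le> t"
proof -
  have "(1 / (2 * sqrt 3))\<^sup>2 \<le> (t - 1 / 2)\<^sup>2"
    using assms by (simp add: power_divide power_mult_distrib power2_eq_square algebra_simps)
  then have "1 / (2 * sqrt 3) \<le> t - 1 / 2" by (rule power2_le_imp_le) (use assms in simp)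
  then show ?thesis by (simp add: t0_def)
qed

text \<open>Here \<open>a\<close> is half of \<open>coth (x / 2)\<close>. The first bound is
  \<open>exp_minus_ineq\<close>; the second is \<open>exp_sum_ineq\<close> multiplied by
  \<open>E = exp (- x)\<close>, which makes it polynomial in \<open>E\<close>, and then divided by
  \<open>6 * (1 - E)^2\<close>.\<close>

lemma bern_gen_aux:
  fixes x :: real
  assumes x: "0 < x"
  defines "a \<equiv> 1 / (1 - exp (- x)) - 1 / 2"
  shows "1 \<le> x * a" "x / 12 \<le> a * (x * a - 1)" "1 / 2 < a"
proof -
  define E where "E = exp (- x)"
  have E: "0 < E" "E < 1" using x by (auto simp: E_def)
  have a: "a = (1 + E) / (2 * (1 - E))" using E by (simp add: a_def E_def[symmetric] field_simps)
  have "2 * (1 - E) \<le> x * (1 + E)" using exp_minus_ineq[of x] x by (simp add: E_def)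
  then show "1 \<le> x * a" using E by (simp add: a pos_le_divide_eq)
  have "E * (3 * (exp x - E)) \<le> E * (x * (exp x + 4 + E))"
    using exp_sum_ineq[of x] x E by (intro mult_left_mono) (auto simp: E_def)
  moreover have "E * (3 * (exp x - E)) = 3 * (E * exp x) - 3 * E\<^sup>2"
    "E * (x * (exp x + 4 + E)) = x * (E * exp x + 4 * E + E\<^sup>2)"
    by (simp_all add: algebra_simps power2_eq_square)
  moreover have "E * exp x = 1" by (simp add: E_def flip: exp_add)
  ultimately have "3 * 1 - 3 * E\<^sup>2 \<le> x * (1 + 4 * E + E\<^sup>2)"
    by (simp only:)
  then have "0 \<le> (x * (1 + 4 * E + E\<^sup>2) - 3 * (1 - E\<^sup>2)) / (6 * (1 - E)\<^sup>2)" by simp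
  also have "\<dots> = a * (x * a - 1) - x / 12"
    using E by (simp add: a divide_simps) (simp add: algebra_simps power2_eq_square power4_eq_xxxx power3_eq_cube)
  finally show "x / 12 \<le> a * (x * a - 1)" by simp
  show "1 / 2 < a" using E by (simp add: a field_simps)
qed

text \<open>Since \<open>g' = g - g^2\<close>, both derivatives are \<open>exp (- t * x)\<close>
  times a polynomial in \<open>g\<close>, \<open>x\<close> and \<open>t\<close>.\<close>

lemma bern_gen_derivs:
  fixes x t :: real
  assumes x: "0 < x"
  defines "g \<equiv> \<lambda>x. 1 / (1 - exp (- x :: real))"
  shows "((\<lambda>x. x * exp (- t * x) / (1 - exp (- x))) has_real_derivative
      exp (- t * x) * g x * (1 + (1 - t) * x - x * g x)) (at x)" (is "(?u has_real_derivative _) _")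
    and "((\<lambda>x. exp (- t * x) * g x * (1 + (1 - t) * x - x * g x)) has_real_derivative
      exp (- t * x) * g x * (2 * (1 - g x - t) + x * ((1 - g x) * (1 - 2 * g x) - 2 * t * (1 - g x) + t\<^sup>2))) (at x)"
proof -
  have g: "(g has_real_derivative g x - (g x)\<^sup>2) (at x)"
    unfolding g_def using x
    by (auto intro!: derivative_eq_intros simp: divide_simps power2_eq_square)
  have u: "?u = (\<lambda>x. x * exp (- t * x) * g x)" by (simp add: g_def)
  show "(?u has_real_derivative exp (- t * x) * g x * (1 + (1 - t) * x - x * g x)) (at x)"
    unfolding u by (rule derivative_eq_intros g refl)+ (simp add: algebra_simps power2_eq_square)
  show "((\<lambda>x. exp (- t * x) * g x * (1 + (1 - t) * x - x * g x)) has_real_derivative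
      exp (- t * x) * g x * (2 * (1 - g x - t) + x * ((1 - g x) * (1 - 2 * g x) - 2 * t * (1 - g x) + t\<^sup>2))) (at x)"
    by (rule derivative_eq_intros g refl)+ (simp add: algebra_simps power2_eq_square power3_eq_cube)
qed

text \<open>With \<open>s = t - 1/2\<close> and \<open>a = g - 1/2\<close>, the second derivative
  has the sign of \<open>2 * (a + s) * (x * a - 1) + x * (s^2 - 1/4)\<close>. The bounds
  \<open>a * (x * a - 1) \<ge> x / 12\<close> and \<open>s^2 \<ge> 1/12\<close> suffice exactly, as
  1/6 + 1/12 = 1/4. The first derivative has the sign of \<open>(1 - x * a) - x * s\<close>.\<close>

lemma bern_gen_convex_antimono:
  assumes t: "t0 \<le> t"
  shows "convex_on {0<..} (bern_gen t)"
    and "0 < x \<Longrightarrow> x \<le> y \<Longrightarrow> bern_gen t y \<le> bern_gen t x"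
proof -
  let ?u = "\<lambda>x. x * exp (- t * x) / (1 - exp (- x))"
  let ?g = "\<lambda>x. 1 / (1 - exp (- x :: real))"
  have "convex_on {0<..} ?u"
  proof (rule f''_ge0_imp_convex[OF _ bern_gen_derivs])
    fix x :: real assume "x \<in> {0<..}"
    then have x: "0 < x" by simp
    define s where "s = t - 1 / 2"
    define a where "a = ?g x - 1 / 2"
    have s: "0 \<le> s" "1 / 12 \<le> s\<^sup>2" using t0_bounds[OF t] by (auto simp: s_def)
    note a = bern_gen_aux[OF x, folded a_def]
    have "x / 6 \<le> 2 * (a + s) * (x * a - 1)"
    proof -
      have "0 \<le> s * (x * a - 1)" using s a by simp
      then show ?thesis using a(2) by (simp add: algebra_simps)
    qed
    moreover have "x * (1 / 12) \<le> x * s\<^sup>2" using s x by (intro mult_left_mono) auto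
    ultimately have "0 \<le> 2 * (a + s) * (x * a - 1) + x * (s\<^sup>2 - 1 / 4)" by (simp add: algebra_simps)
    also have "\<dots> = 2 * (1 - ?g x - t) + x * ((1 - ?g x) * (1 - 2 * ?g x) - 2 * t * (1 - ?g x) + t\<^sup>2)"
    proof -
      have "?g x = a + 1 / 2" "t = s + 1 / 2" by (auto simp: a_def s_def)
      then show ?thesis by (simp only:) (simp add: field_simps power2_eq_square)
    qed
    finally show "0 \<le> exp (- t * x) * ?g x *
       (2 * (1 - ?g x - t) + x * ((1 - ?g x) * (1 - 2 * ?g x) - 2 * t * (1 - ?g x) + t\<^sup>2))"
      using x by (intro mult_nonneg_nonneg) auto
  qed auto
  then show "convex_on {0<..} (bern_gen t)"
    by (rule convex_on_eq_on) (simp add: bern_gen_def)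
  assume xy: "0 < x" "x \<le> y"
  have "?u y \<le> ?u x"
  proof (rule DERIV_nonpos_imp_nonincreasing[OF xy(2)])
    fix z assume "x \<le> z" "z \<le> y"
    then have z: "0 < z" using xy by simp
    have "1 + (1 - t) * z - z * ?g z = (1 - z * (?g z - 1 / 2)) - z * (t - 1 / 2)"
      by (simp add: algebra_simps)
    also have "\<dots> \<le> 0"
      using bern_gen_aux(1)[OF z] t0_bounds(1)[OF t] z mult_nonneg_nonneg[of z "t - 1 / 2"] by linarith
    finally have "exp (- t * z) * ?g z * (1 + (1 - t) * z - z * ?g z) \<le> 0"
      using z by (intro mult_nonneg_nonpos) auto
    with bern_gen_derivs(1)[OF z, of t] show "\<exists>d. (?u has_real_derivative d) (at z) \<and> d \<le> 0" by blast
  qed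
  then show "bern_gen t y \<le> bern_gen t x" using xy by (simp add: bern_gen_def)
qed

section \<open>Monotonicity of the Levy density\<close>

definition levy_k :: "real \<Rightarrow> real \<Rightarrow> real \<Rightarrow> real" where
  "levy_k \<alpha> t x = \<alpha> * (bern_gen t x - bern_gen t (x / \<alpha>)) / x"

lemma levy_k_nonneg:
  assumes "0 < \<alpha>" "\<alpha> < 1" "t0 \<le> t" "0 < x"
  shows "0 \<le> levy_k \<alpha> t x"
proof -
  have "x \<le> x / \<alpha>" using assms by (simp add: pos_le_divide_eq mult_left_le)
  then show ?thesis
    unfolding levy_k_def using assms bern_gen_convex_antimono(2)[of t x "x / \<alpha>"] by simp
qed

text \<open>Up to a negative factor, \<open>levy_k\<close> is the slope of a chord of the convex function \<open>bern_gen\<close>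
  both of whose end points increase with \<open>x\<close>.\<close>
lemma levy_k_antimono:
  assumes \<alpha>: "0 < \<alpha>" "\<alpha> < 1" and t: "t0 \<le> t" and xy: "0 < x" "x \<le> y"
  shows "levy_k \<alpha> t y \<le> levy_k \<alpha> t x"
proof (cases "x = y")
  case False
  then have xy: "0 < x" "x < y" using xy by auto
  define b where "b = 1 / \<alpha>"
  have b: "1 < b" using \<alpha> by (simp add: b_def)
  let ?u = "bern_gen t"
  note conv = bern_gen_convex_antimono(1)[OF t]
  have bx: "x < b * x" "y < b * y" "b * x < b * y" "x < b * y" using b xy
    by (auto intro: less_trans[of x y "b * y"])
  have sl: "(p - q) / (r - s) = (q - p) / (s - r)" for p q r s :: real
    by (metis minus_diff_eq minus_divide_divide)
  \<comment> \<open>The chords over \<open>[x, b * x]\<close> and \<open>[y, b * y]\<close> are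
    compared through the one over \<open>[x, b * y]\<close>: moving one end at a time to the right
    raises the slope.\<close>
  have "(?u (b * x) - ?u x) / (b * x - x) \<le> (?u (b * y) - ?u x) / (b * y - x)"
    using convex_on_slope_le(1)[OF conv, of x "b * y" "b * x"] xy bx b unfolding sl[of "?u x"] by simp
  also have "\<dots> \<le> (?u (b * y) - ?u y) / (b * y - y)"
    using convex_on_slope_le(2)[OF conv, of x "b * y" y] xy bx b unfolding sl[of _ "?u (b * y)"] by simp
  finally have "(?u (b * x) - ?u x) / ((b - 1) * x) \<le> (?u (b * y) - ?u y) / ((b - 1) * y)"
    by (simp add: left_diff_distrib)
  then have "(b - 1) * ((?u (b * x) - ?u x) / ((b - 1) * x)) \<le> (b - 1) * ((?u (b * y) - ?u y) / ((b - 1) * y))"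
    using b by (intro mult_left_mono) auto
  then have "(?u (b * x) - ?u x) / x \<le> (?u (b * y) - ?u y) / y"
    using b by simp
  then have "\<alpha> * ((?u (b * x) - ?u x) / x) \<le> \<alpha> * ((?u (b * y) - ?u y) / y)"
    using \<alpha> by (intro mult_left_mono) auto
  then show ?thesis by (simp add: levy_k_def b_def right_diff_distrib diff_divide_distrib)
qed simp

section \<open>Digamma and trigamma functions\<close>

lemma pos_notin_nonpos_Ints: "0 < (x::real) \<Longrightarrow> x \<notin> \<int>\<^sub>\<le>\<^sub>0"
  by (auto elim!: nonpos_Ints_cases)

lemma Polygamma_measurable [measurable]: "(Polygamma n :: real \<Rightarrow> real) \<in> borel_measurable borel"
  unfolding Polygamma_def [abs_def] by measurable

text \<open>By the mean value theorem for \<open>ln_Gamma\<close> on \<open>[x, x + 1]\<close>,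
  \<open>ln x\<close> is a value of \<open>Digamma\<close> there; monotonicity and the recurrence
  give both bounds.\<close>

lemma Digamma_bounds:
  fixes x :: real
  assumes x: "0 < x"
  shows "ln x - 1 / x \<le> Digamma x" "Digamma x \<le> ln x"
proof -
  have "\<exists>\<xi>. x < \<xi> \<and> \<xi> < x + 1 \<and> ln_Gamma (x + 1) - ln_Gamma x = (x + 1 - x) * Digamma \<xi>"
    using x by (intro MVT2 derivative_intros) auto
  then obtain z where z: "x < z" "z < x + 1" "ln_Gamma (x + 1) - ln_Gamma x = Digamma z" by auto
  have "ln_Gamma (x + 1) - ln_Gamma x = ln x"
    using x Gamma_plus1[OF pos_notin_nonpos_Ints[OF x]] Gamma_real_pos[OF x]
    by (simp add: ln_Gamma_real_pos ln_mult add_pos_pos del: Gamma_real_pos)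
  with z have "ln x = Digamma z" by simp
  moreover have "Digamma x \<le> Digamma z" "Digamma z \<le> Digamma (x + 1)"
    using x z by (auto intro!: Polygamma_real_mono)
  moreover have "Digamma (x + 1) = Digamma x + 1 / x" using x by (intro Digamma_plus1) auto
  ultimately show "ln x - 1 / x \<le> Digamma x" "Digamma x \<le> ln x" by auto
qed

lemma Trigamma_sums:
  fixes x :: real
  assumes "0 < x"
  shows "(\<lambda>k. 1 / (x + real k)\<^sup>2) sums Polygamma 1 x"
  using Polygamma_LIMSEQ[of x 1] assms by (simp add: inverse_eq_divide numeral_2_eq_2)

text \<open>The series of \<open>1 / (x + k)^2\<close> is compared term by term with the telescoping
  series of \<open>A\<close>, whose sum is \<open>A x\<close>.\<close>

lemma Trigamma_bounds_of_telescope: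
  fixes A :: "real \<Rightarrow> real"
  assumes x: "0 < x" and A: "(A \<longlongrightarrow> 0) at_top"
  shows "(\<And>z. x \<le> z \<Longrightarrow> 1 / z\<^sup>2 \<le> A z - A (z + 1)) \<Longrightarrow> Polygamma 1 x \<le> A x"
    and "(\<And>z. x \<le> z \<Longrightarrow> A z - A (z + 1) \<le> 1 / z\<^sup>2) \<Longrightarrow> A x \<le> Polygamma 1 x"
proof -
  have "(\<lambda>n. A (x + real n)) \<longlonglongrightarrow> 0"
    by (rule filterlim_compose[OF A])
       (intro filterlim_tendsto_add_at_top[OF tendsto_const] filterlim_real_sequentially)
  from telescope_sums'[OF this] have s: "(\<lambda>n. A (x + real n) - A (x + real n + 1)) sums A x"
    by (simp add: add_ac)
  show "Polygamma 1 x \<le> A x" if "\<And>z. x \<le> z \<Longrightarrow> 1 / z\<^sup>2 \<le> A z - A (z + 1)"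
    by (rule sums_le[OF _ Trigamma_sums[OF x] s]) (use that in auto)
  show "A x \<le> Polygamma 1 x" if "\<And>z. x \<le> z \<Longrightarrow> A z - A (z + 1) \<le> 1 / z\<^sup>2"
    by (rule sums_le[OF _ s Trigamma_sums[OF x]]) (use that in auto)
qed

text \<open>The truncated asymptotic series \<open>1/x + 1/(2x\<^sup>2) + 1/(6x\<^sup>3)\<close> telescopes to \<open>1/x\<^sup>2\<close> up to an
  error of order \<open>1/x\<^sup>6\<close>.\<close>
lemma Trigamma_bounds:
  fixes x :: real
  assumes x: "1 \<le> x"
  shows "Polygamma 1 x \<le> 1 / x + 1 / (2 * x\<^sup>2) + 1 / (6 * x ^ 3)"
    and "1 / x + 1 / (2 * x\<^sup>2) + 1 / (6 * x ^ 3) - 1 / x ^ 4 \<le> Polygamma 1 x"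
proof -
  show "Polygamma 1 x \<le> 1 / x + 1 / (2 * x\<^sup>2) + 1 / (6 * x ^ 3)"
  proof (rule Trigamma_bounds_of_telescope(1)[where A = "\<lambda>x. 1 / x + 1 / (2 * x\<^sup>2) + 1 / (6 * x ^ 3)"])
    fix z assume "x \<le> z"
    then have z: "0 < z" using x by simp
    have "1 / z + 1 / (2 * z\<^sup>2) + 1 / (6 * z ^ 3) - (1 / (z + 1) + 1 / (2 * (z + 1)\<^sup>2) + 1 / (6 * (z + 1) ^ 3)) - 1 / z\<^sup>2
      = 1 / (6 * z ^ 3 * (z + 1) ^ 3)"
      using z by (simp add: divide_simps) algebra
    moreover have "0 \<le> 1 / (6 * z ^ 3 * (z + 1) ^ 3)" using z by simp
    ultimately show "1 / z\<^sup>2 \<le> 1 / z + 1 / (2 * z\<^sup>2) + 1 / (6 * z ^ 3) - (1 / (z + 1) + 1 / (2 * (z + 1)\<^sup>2) + 1 / (6 * (z + 1) ^ 3))"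
      by (metis diff_ge_0_iff_ge)
  qed (use x in simp, real_asymp)
  show "1 / x + 1 / (2 * x\<^sup>2) + 1 / (6 * x ^ 3) - 1 / x ^ 4 \<le> Polygamma 1 x"
  \<comment> \<open>Subtracting \<open>1 / x ^ 4\<close> lowers the difference at \<open>z\<close>
    by \<open>1 / z ^ 4 - 1 / (z + 1) ^ 4\<close>, which outweighs the positive error
    \<open>1 / (6 * z ^ 3 * (z + 1) ^ 3)\<close> of the upper bound.\<close>
  proof (rule Trigamma_bounds_of_telescope(2)[where A = "\<lambda>x. 1 / x + 1 / (2 * x\<^sup>2) + 1 / (6 * x ^ 3) - 1 / x ^ 4"])
    fix z assume "x \<le> z"
    then have z: "1 \<le> z" using x by simp
    have "1 / z + 1 / (2 * z\<^sup>2) + 1 / (6 * z ^ 3) - 1 / z ^ 4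
        - (1 / (z + 1) + 1 / (2 * (z + 1)\<^sup>2) + 1 / (6 * (z + 1) ^ 3) - 1 / (z + 1) ^ 4) - 1 / z\<^sup>2
      = (z * (z + 1) - 6 * ((z + 1) ^ 4 - z ^ 4)) / (6 * z ^ 4 * (z + 1) ^ 4)"
      using z by (simp add: divide_simps) algebra
    also have "\<dots> \<le> 0"
    proof (rule divide_nonpos_nonneg)
      have "z * (z + 1) - 6 * ((z + 1) ^ 4 - z ^ 4) = - (24 * z ^ 3 + 35 * z\<^sup>2 + 23 * z + 6)" by algebra
      also have "\<dots> \<le> 0" using z zero_le_power[of z 3] zero_le_power[of z 2] by linarith
      finally show "z * (z + 1) - 6 * ((z + 1) ^ 4 - z ^ 4) \<le> 0" .
    qed (use z in simp)
    finally show "1 / z + 1 / (2 * z\<^sup>2) + 1 / (6 * z ^ 3) - 1 / z ^ 4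
        - (1 / (z + 1) + 1 / (2 * (z + 1)\<^sup>2) + 1 / (6 * (z + 1) ^ 3) - 1 / (z + 1) ^ 4) \<le> 1 / z\<^sup>2"
      by simp
  qed (use x in simp, real_asymp)
qed

text \<open>Third-order expansion of the trigamma function. The two bounds differ by
  \<open>1 / (l + t) ^ 4\<close>, negligible against \<open>l ^ 3\<close>, so both sides share the
  limit; the larger root of this limit in \<open>t\<close> is \<open>t0\<close>.\<close>

lemma Trigamma_expansion:
  fixes t :: real
  shows "((\<lambda>l. l ^ 3 * Polygamma 1 (l + t) - l\<^sup>2 - (1 / 2 - t) * l) \<longlongrightarrow> t\<^sup>2 - t + 1 / 6) at_top"
proof (rule tendsto_sandwich)
  have ev: "\<forall>\<^sub>F l in at_top. 1 \<le> l + t \<and> 0 \<le> l"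
    using eventually_ge_at_top[of "max 0 (1 - t)"] by eventually_elim auto
  show "\<forall>\<^sub>F l in at_top. l ^ 3 * (1 / (l + t) + 1 / (2 * (l + t)\<^sup>2) + 1 / (6 * (l + t) ^ 3) - 1 / (l + t) ^ 4) - l\<^sup>2 - (1 / 2 - t) * l
      \<le> l ^ 3 * Polygamma 1 (l + t) - l\<^sup>2 - (1 / 2 - t) * l"
    using ev by eventually_elim (intro diff_right_mono mult_left_mono Trigamma_bounds; simp)
  show "\<forall>\<^sub>F l in at_top. l ^ 3 * Polygamma 1 (l + t) - l\<^sup>2 - (1 / 2 - t) * l
      \<le> l ^ 3 * (1 / (l + t) + 1 / (2 * (l + t)\<^sup>2) + 1 / (6 * (l + t) ^ 3)) - l\<^sup>2 - (1 / 2 - t) * l"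
    using ev by eventually_elim (intro diff_right_mono mult_left_mono Trigamma_bounds; simp)
  show "((\<lambda>l. l ^ 3 * (1 / (l + t) + 1 / (2 * (l + t)\<^sup>2) + 1 / (6 * (l + t) ^ 3) - 1 / (l + t) ^ 4) - l\<^sup>2 - (1 / 2 - t) * l)
      \<longlongrightarrow> t\<^sup>2 - t + 1 / 6) at_top"
    by (real_asymp simp: power2_eq_square algebra_simps)
  show "((\<lambda>l. l ^ 3 * (1 / (l + t) + 1 / (2 * (l + t)\<^sup>2) + 1 / (6 * (l + t) ^ 3)) - l\<^sup>2 - (1 / 2 - t) * l)
      \<longlongrightarrow> t\<^sup>2 - t + 1 / 6) at_top"
    by (real_asymp simp: power2_eq_square algebra_simps)
qed

lemma nn_integral_x_exp:
  fixes s :: real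
  assumes s: "0 < s"
  shows "(\<integral>\<^sup>+x. ennreal (x * exp (- s * x)) * indicator {0..} x \<partial>lborel) = ennreal (1 / s\<^sup>2)"
proof -
  have "(\<integral>\<^sup>+x. ennreal (x * exp (- s * x)) * indicator {0..} x \<partial>lborel)
      = 0 - (- (0 / s + 1 / s\<^sup>2) * exp (- s * 0))"
  proof (rule nn_integral_FTC_atLeast[where F = "\<lambda>x. - (x / s + 1 / s\<^sup>2) * exp (- s * x)"])
    show "((\<lambda>x. - (x / s + 1 / s\<^sup>2) * exp (- s * x)) \<longlongrightarrow> 0) at_top"
      using s by real_asymp
    show "((\<lambda>x. - (x / s + 1 / s\<^sup>2) * exp (- s * x)) has_real_derivative x * exp (- s * x)) (at x)" for x
      using s by (auto intro!: derivative_eq_intros simp: field_simps power2_eq_square)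
  qed auto
  then show ?thesis by simp
qed

text \<open>Expanding \<open>1 / (1 - exp (- x))\<close> as a geometric series and integrating
  termwise gives the trigamma series.\<close>

lemma nn_integral_bern_gen:
  assumes z: "0 < l + t"
  shows "(\<integral>\<^sup>+x. ennreal (exp (- l * x) * bern_gen t x) \<partial>lborel) = ennreal (Polygamma 1 (l + t))"
proof -
  let ?f = "\<lambda>k x. ennreal (x * exp (- (l + t + real k) * x)) * indicator {0..} x"
  have "ennreal (exp (- l * x) * bern_gen t x) = (\<Sum>k. ?f k x)" for x
  proof (cases "0 < x")
    case True
    have "(\<lambda>k. exp (- x) ^ k) sums (1 / (1 - exp (- x)))" using True by (intro geometric_sums) simp
    from sums_mult[OF this, of "x * exp (- (l + t) * x)"]
    have "(\<lambda>k. x * exp (- (l + t + real k) * x)) sums (exp (- l * x) * bern_gen t x)"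
      using True by (simp add: bern_gen_def algebra_simps flip: exp_add exp_of_nat_mult)
    then have "(\<Sum>k. ennreal (x * exp (- (l + t + real k) * x))) = ennreal (exp (- l * x) * bern_gen t x)"
      using True by (intro suminf_ennreal_eq) auto
    with True show ?thesis by simp
  next
    case False
    then have "?f k x = 0" for k by (auto split: split_indicator)
    then show ?thesis using False by (simp only:) (simp add: bern_gen_def)
  qed
  then have "(\<integral>\<^sup>+x. ennreal (exp (- l * x) * bern_gen t x) \<partial>lborel) = (\<Sum>k. \<integral>\<^sup>+x. ?f k x \<partial>lborel)"
    by (simp only:) (rule nn_integral_suminf, measurable)
  also have "\<dots> = (\<Sum>k. ennreal (1 / (l + t + real k)\<^sup>2))"
    using z by (intro suminf_cong nn_integral_x_exp) auto
  also have "\<dots> = ennreal (Polygamma 1 (l + t))"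
    by (rule suminf_ennreal_eq[OF _ Trigamma_sums[OF z]]) auto
  finally show ?thesis .
qed

lemma has_bochner_integral_bern_gen:
  assumes z: "0 < l + t"
  shows "has_bochner_integral lborel (\<lambda>x. exp (- l * x) * bern_gen t x) (Polygamma 1 (l + t))"
  using nn_integral_bern_gen[OF z] Polygamma_real_odd_pos[OF pos_notin_nonpos_Ints[OF z], of 1]
  by (intro has_bochner_integral_nn_integral) (auto intro!: AE_I2 mult_nonneg_nonneg bern_gen_nonneg)

section \<open>The Levy density of G\<close>

definition ln_G :: "real \<Rightarrow> real \<Rightarrow> real \<Rightarrow> real" where
  "ln_G \<alpha> t l = (1 - \<alpha>) * ln_Gamma t + \<alpha> * l * ln \<alpha> + \<alpha> * ln_Gamma (l + t) - ln_Gamma (\<alpha> * l + t)"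

definition ln_G' :: "real \<Rightarrow> real \<Rightarrow> real \<Rightarrow> real" where
  "ln_G' \<alpha> t l = \<alpha> * (ln \<alpha> + Digamma (l + t) - Digamma (\<alpha> * l + t))"

definition ln_G'' :: "real \<Rightarrow> real \<Rightarrow> real \<Rightarrow> real" where
  "ln_G'' \<alpha> t l = \<alpha> * Polygamma 1 (l + t) - \<alpha>\<^sup>2 * Polygamma 1 (\<alpha> * l + t)"

lemma G_eq_exp:
  assumes "0 < \<alpha>" "0 < t" "0 \<le> l"
  shows "G \<alpha> t l = exp (ln_G \<alpha> t l)"
proof -
  have "0 < l + t" "0 < \<alpha> * l + t" using assms by (auto intro: add_nonneg_pos)
  then show ?thesis
    using assms unfolding G_def ln_G_def
    by (simp add: powr_def ln_Gamma_real_pos exp_add exp_diff Gamma_real_pos[THEN less_imp_neq[THEN not_sym]])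
qed

text \<open>Reduces \<alpha> > 1 to 1/\<alpha> < 1 at the cost of a factor and a dilation, which is
  why later results concern \<open>a * ln_G \<alpha> t (b * l)\<close>.\<close>

lemma ln_G_inverse:
  assumes "0 < \<alpha>"
  shows "ln_G \<alpha> t l = - \<alpha> * ln_G (1 / \<alpha>) t (\<alpha> * l)"
  using assms by (simp add: ln_G_def ln_div algebra_simps)

lemma ln_G_0: "ln_G \<alpha> t 0 = 0"
  by (simp add: ln_G_def algebra_simps)

lemma ln_G_deriv:
  assumes "0 < \<alpha>" "0 < t" "0 \<le> l"
  shows "(ln_G \<alpha> t has_real_derivative ln_G' \<alpha> t l) (at l)"
    and "(ln_G' \<alpha> t has_real_derivative ln_G'' \<alpha> t l) (at l)"
proof -
  have p: "0 < l + t" "0 < \<alpha> * l + t" using assms by (auto intro: add_nonneg_pos)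
  have 1: "((\<lambda>l. ln_Gamma (l + t)) has_real_derivative Digamma (l + t)) (at l)"
    by (rule DERIV_cong[OF DERIV_chain2[where f = ln_Gamma and g = "\<lambda>l. l + t" and x = l and s = UNIV and Da = "Digamma (l + t)" and Db = 1]])
       (use has_field_derivative_ln_Gamma_real[OF p(1)] in \<open>auto intro!: derivative_eq_intros\<close>)
  have 2: "((\<lambda>l. ln_Gamma (\<alpha> * l + t)) has_real_derivative \<alpha> * Digamma (\<alpha> * l + t)) (at l)"
    by (rule DERIV_cong[OF DERIV_chain2[where f = ln_Gamma and g = "\<lambda>l. \<alpha> * l + t" and x = l and s = UNIV and Da = "Digamma (\<alpha> * l + t)" and Db = \<alpha>]])
       (use has_field_derivative_ln_Gamma_real[OF p(2)] in \<open>auto intro!: derivative_eq_intros\<close>)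
  show "(ln_G \<alpha> t has_real_derivative ln_G' \<alpha> t l) (at l)"
    unfolding ln_G_def [abs_def] ln_G'_def
    by (rule derivative_eq_intros 1 2 refl)+ (simp add: algebra_simps)
  have 3: "((\<lambda>l. Digamma (l + t)) has_real_derivative Polygamma 1 (l + t)) (at l)"
    by (rule DERIV_cong[OF DERIV_chain2[where f = Digamma and g = "\<lambda>l. l + t" and x = l and s = UNIV and Da = "Polygamma 1 (l + t)" and Db = 1]])
       (use has_field_derivative_Polygamma[OF pos_notin_nonpos_Ints[OF p(1)], of 0] in \<open>auto intro!: derivative_eq_intros\<close>)
  have 4: "((\<lambda>l. Digamma (\<alpha> * l + t)) has_real_derivative \<alpha> * Polygamma 1 (\<alpha> * l + t)) (at l)"
    by (rule DERIV_cong[OF DERIV_chain2[where f = Digamma and g = "\<lambda>l. \<alpha> * l + t" and x = l and s = UNIV and Da = "Polygamma 1 (\<alpha> * l + t)" and Db = \<alpha>]])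
       (use has_field_derivative_Polygamma[OF pos_notin_nonpos_Ints[OF p(2)], of 0] in \<open>auto intro!: derivative_eq_intros\<close>)
  show "(ln_G' \<alpha> t has_real_derivative ln_G'' \<alpha> t l) (at l)"
    unfolding ln_G'_def [abs_def] ln_G''_def
    by (rule derivative_eq_intros 3 4 refl)+ (simp add: algebra_simps power2_eq_square)
qed

text \<open>The factor \<open>\<alpha> powr (\<alpha> * lam)\<close> of \<open>G\<close> contributes
  \<open>ln \<alpha>\<close>, which exactly cancels the limit of
  \<open>ln (l + t) - ln (\<alpha> * l + t)\<close>. Hence the exponent has no drift.\<close>

lemma ln_G'_tendsto_0:
  assumes \<alpha>: "0 < \<alpha>" and t: "0 < t"
  shows "(ln_G' \<alpha> t \<longlongrightarrow> 0) at_top"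
proof (rule tendsto_sandwich)
  show "\<forall>\<^sub>F l in at_top. \<alpha> * (ln \<alpha> + (ln (l + t) - 1 / (l + t)) - ln (\<alpha> * l + t)) \<le> ln_G' \<alpha> t l"
    using eventually_ge_at_top[of 0]
  proof eventually_elim
    case (elim l)
    then have "0 < l + t" "0 < \<alpha> * l + t" using assms by (auto intro: add_nonneg_pos)
    from Digamma_bounds[OF this(1)] Digamma_bounds[OF this(2)] show ?case
      unfolding ln_G'_def using \<alpha> by (intro mult_left_mono) linarith+
  qed
  show "\<forall>\<^sub>F l in at_top. ln_G' \<alpha> t l \<le> \<alpha> * (ln \<alpha> + ln (l + t) - (ln (\<alpha> * l + t) - 1 / (\<alpha> * l + t)))"
    using eventually_ge_at_top[of 0]
  proof eventually_elim
    case (elim l)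
    then have "0 < l + t" "0 < \<alpha> * l + t" using assms by (auto intro: add_nonneg_pos)
    from Digamma_bounds[OF this(1)] Digamma_bounds[OF this(2)] show ?case
      unfolding ln_G'_def using \<alpha> by (intro mult_left_mono) linarith+
  qed
  show "((\<lambda>l. \<alpha> * (ln \<alpha> + (ln (l + t) - 1 / (l + t)) - ln (\<alpha> * l + t))) \<longlongrightarrow> 0) at_top"
    using assms by real_asymp
  show "((\<lambda>l. \<alpha> * (ln \<alpha> + ln (l + t) - (ln (\<alpha> * l + t) - 1 / (\<alpha> * l + t)))) \<longlongrightarrow> 0) at_top"
    using assms by real_asymp
qed

lemma levy_k_measurable [measurable]: "levy_k \<alpha> t \<in> borel_measurable borel"
  unfolding levy_k_def [abs_def] by measurable

lemma ln_G_measurable [measurable]: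
  "ln_G' \<alpha> t \<in> borel_measurable borel" "ln_G'' \<alpha> t \<in> borel_measurable borel"
  unfolding ln_G'_def [abs_def] ln_G''_def [abs_def] by measurable

lemma levy_k_eq_0: "0 < \<alpha> \<Longrightarrow> x \<le> 0 \<Longrightarrow> levy_k \<alpha> t x = 0"
  by (simp add: levy_k_def bern_gen_def zero_less_divide_iff)

context
  fixes \<alpha> t :: real
  assumes \<alpha>: "0 < \<alpha>" "\<alpha> < 1" and t: "t0 \<le> t"
begin

lemma t_pos: "0 < t"
  using t0_bounds[OF t] by simp

lemma levy_k_nonneg': "0 \<le> levy_k \<alpha> t x"
  using levy_k_nonneg[OF \<alpha> t, of x] levy_k_eq_0[OF \<alpha>(1), of x t] by (cases "0 < x") auto

text \<open>The trigamma representation and its rescaling by \<alpha> are subtracted. The sign of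
  \<open>ln_G''\<close> is then inherited from \<open>levy_k\<close>.\<close>

lemma nn_integral_levy_k_2:
  assumes l: "0 \<le> l"
  shows "(\<integral>\<^sup>+x. ennreal (exp (- l * x) * (x * levy_k \<alpha> t x)) \<partial>lborel) = ennreal (ln_G'' \<alpha> t l)"
    and "0 \<le> ln_G'' \<alpha> t l"
proof -
  have p: "0 < l + t" "0 < \<alpha> * l + t" using t_pos \<alpha> l by (auto intro: add_nonneg_pos)
  \<comment> \<open>The substitution of \<open>x / \<alpha>\<close> for \<open>x\<close>, spelled as
    an affine map to match the change of variables.\<close>
  have "has_bochner_integral lborel (\<lambda>x. exp (- (\<alpha> * l) * (0 + 1 / \<alpha> * x)) * bern_gen t (0 + 1 / \<alpha> * x))
      (Polygamma 1 (\<alpha> * l + t) /\<^sub>R \<bar>1 / \<alpha>\<bar>)"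
    using has_bochner_integral_bern_gen[OF p(2)] \<alpha>
    by (subst (asm) lborel_has_bochner_integral_real_affine_iff[of "1 / \<alpha>" _ _ 0]) auto
  then have "has_bochner_integral lborel (\<lambda>x. exp (- l * x) * bern_gen t (x / \<alpha>)) (\<alpha> * Polygamma 1 (\<alpha> * l + t))"
    using \<alpha> by simp
  from has_bochner_integral_diff[OF has_bochner_integral_bern_gen[OF p(1)] this]
  have "has_bochner_integral lborel (\<lambda>x. \<alpha> * (exp (- l * x) * bern_gen t x - exp (- l * x) * bern_gen t (x / \<alpha>)))
     (\<alpha> * (Polygamma 1 (l + t) - \<alpha> * Polygamma 1 (\<alpha> * l + t)))"
    by (rule has_bochner_integral_mult_right)
  also have "(\<lambda>x. \<alpha> * (exp (- l * x) * bern_gen t x - exp (- l * x) * bern_gen t (x / \<alpha>)))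
      = (\<lambda>x. exp (- l * x) * (x * levy_k \<alpha> t x))"
  proof
    fix x
    \<comment> \<open>At \<open>x = 0\<close> division yields 0, and the right side vanishes too
      because \<open>bern_gen t 0 = 0\<close>.\<close>
    have "x * levy_k \<alpha> t x = \<alpha> * (bern_gen t x - bern_gen t (x / \<alpha>))"
    proof (cases "x = 0")
      case True
      then show ?thesis by (simp add: bern_gen_def)
    qed (simp add: levy_k_def)
    then show "\<alpha> * (exp (- l * x) * bern_gen t x - exp (- l * x) * bern_gen t (x / \<alpha>))
       = exp (- l * x) * (x * levy_k \<alpha> t x)"
      by (simp only:) (simp add: algebra_simps)
  qed
  also have "\<alpha> * (Polygamma 1 (l + t) - \<alpha> * Polygamma 1 (\<alpha> * l + t)) = ln_G'' \<alpha> t l"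
    by (simp add: ln_G''_def right_diff_distrib power2_eq_square)
  finally have hb: "has_bochner_integral lborel (\<lambda>x. exp (- l * x) * (x * levy_k \<alpha> t x)) (ln_G'' \<alpha> t l)" .
  have nn: "0 \<le> exp (- l * x) * (x * levy_k \<alpha> t x)" for x
    using levy_k_nonneg'[of x] levy_k_eq_0[OF \<alpha>(1), of x t] by (cases "0 < x") auto
  show "(\<integral>\<^sup>+x. ennreal (exp (- l * x) * (x * levy_k \<alpha> t x)) \<partial>lborel) = ennreal (ln_G'' \<alpha> t l)"
    using hb nn by (subst nn_integral_eq_integral) (auto simp: has_bochner_integral_iff)
  show "0 \<le> ln_G'' \<alpha> t l"
    unfolding has_bochner_integral_integral_eq[OF hb, symmetric] using nn by (rule Bochner_Integration.integral_nonneg)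
qed

text \<open>First integration, over \<open>{l..}\<close>: the boundary term at infinity vanishes by
  \<open>ln_G'_tendsto_0\<close>, and integrating \<open>x * exp (- s * x)\<close> over
  \<open>s \<ge> l\<close> leaves \<open>exp (- l * x)\<close>.\<close>

lemma nn_integral_levy_k_1:
  assumes l: "0 \<le> l"
  shows "(\<integral>\<^sup>+x. ennreal (exp (- l * x) * levy_k \<alpha> t x) \<partial>lborel) = ennreal (- ln_G' \<alpha> t l)"
proof -
  have "(\<integral>\<^sup>+s. ennreal (ln_G'' \<alpha> t s) * indicator {l..} s \<partial>lborel) = ennreal (0 - ln_G' \<alpha> t l)"
  proof (rule nn_integral_FTC_atLeast)
    show "(ln_G' \<alpha> t has_real_derivative ln_G'' \<alpha> t s) (at s)" "0 \<le> ln_G'' \<alpha> t s" if "l \<le> s" for s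
      using that l by (auto intro!: ln_G_deriv(2) nn_integral_levy_k_2(2) \<alpha> t_pos)
  qed (auto intro!: ln_G'_tendsto_0 \<alpha> t_pos)
  then have "ennreal (- ln_G' \<alpha> t l) = (\<integral>\<^sup>+s. ennreal (ln_G'' \<alpha> t s) * indicator {l..} s \<partial>lborel)" by simp
  also have "\<dots> = (\<integral>\<^sup>+s. \<integral>\<^sup>+x. ennreal (exp (- s * x) * (x * levy_k \<alpha> t x)) * indicator {l..} s \<partial>lborel \<partial>lborel)"
    using l by (intro nn_integral_cong)
      (auto split: split_indicator simp: nn_integral_levy_k_2(1)[symmetric])
  also have "\<dots> = (\<integral>\<^sup>+x. \<integral>\<^sup>+s. ennreal (exp (- s * x) * (x * levy_k \<alpha> t x)) * indicator {l..} s \<partial>lborel \<partial>lborel)"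
    by (rule lborel_pair.Fubini') measurable
  also have "\<dots> = (\<integral>\<^sup>+x. ennreal (exp (- l * x) * levy_k \<alpha> t x) \<partial>lborel)"
  proof (rule nn_integral_cong)
    fix x
    show "(\<integral>\<^sup>+s. ennreal (exp (- s * x) * (x * levy_k \<alpha> t x)) * indicator {l..} s \<partial>lborel)
        = ennreal (exp (- l * x) * levy_k \<alpha> t x)"
    proof (cases "0 < x")
      case True
      have "(\<integral>\<^sup>+s. ennreal (exp (- s * x) * (x * levy_k \<alpha> t x)) * indicator {l..} s \<partial>lborel)
          = ennreal (0 - - exp (- l * x) * levy_k \<alpha> t x)"
      proof (rule nn_integral_FTC_atLeast[where F = "\<lambda>s. - exp (- s * x) * levy_k \<alpha> t x"])
        show "((\<lambda>s. - exp (- s * x) * levy_k \<alpha> t x) has_real_derivative exp (- s * x) * (x * levy_k \<alpha> t x)) (at s)" for s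
          by (auto intro!: derivative_eq_intros)
        have "((\<lambda>s. exp (- s * x)) \<longlongrightarrow> 0) at_top" using True by real_asymp
        then show "((\<lambda>s. - exp (- s * x) * levy_k \<alpha> t x) \<longlongrightarrow> 0) at_top"
          using tendsto_mult_left_zero[of "\<lambda>s. exp (- s * x)" at_top "- levy_k \<alpha> t x"] by simp
      qed (use True levy_k_nonneg' in auto)
      then show ?thesis by simp
    qed (simp add: levy_k_eq_0[OF \<alpha>(1)])
  qed
  finally show ?thesis by simp
qed

text \<open>Second integration, over \<open>{0..l}\<close>, starting from
  \<open>ln_G \<alpha> t 0 = 0\<close>: the inner integral of \<open>exp (- s * x)\<close> is
  \<open>(1 - exp (- l * x)) / x\<close>.\<close>

lemma nn_integral_levy_k:
  assumes l: "0 \<le> l"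
  shows "(\<integral>\<^sup>+x. ennreal ((1 - exp (- l * x)) * (levy_k \<alpha> t x / x)) \<partial>lborel) = ennreal (- ln_G \<alpha> t l)"
    and "ln_G \<alpha> t l \<le> 0"
proof -
  \<comment> \<open>\<open>ln_G'\<close> is nondecreasing with limit 0 at infinity, so it is
    nonpositive.\<close>
  have D: "ln_G' \<alpha> t s \<le> 0" if "0 \<le> s" for s
  proof (rule tendsto_lowerbound[OF ln_G'_tendsto_0[OF \<alpha>(1) t_pos]])
    show "\<forall>\<^sub>F r in at_top. ln_G' \<alpha> t s \<le> ln_G' \<alpha> t r"
      using eventually_ge_at_top[of s]
    proof eventually_elim
      case (elim r)
      show ?case
      proof (rule DERIV_nonneg_imp_nondecreasing[OF elim])
        fix x assume "s \<le> x" "x \<le> r"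
        then have "0 \<le> x" using that by simp
        then show "\<exists>y. (ln_G' \<alpha> t has_real_derivative y) (at x) \<and> 0 \<le> y"
          using ln_G_deriv(2)[OF \<alpha>(1) t_pos] nn_integral_levy_k_2(2) by blast
      qed
    qed
  qed simp
  have d: "((\<lambda>l. - ln_G \<alpha> t l) has_real_derivative - ln_G' \<alpha> t s) (at s)" if "0 \<le> s" for s
    using that \<alpha> t_pos by (intro DERIV_minus ln_G_deriv(1)) auto
  have "- ln_G \<alpha> t 0 \<le> - ln_G \<alpha> t l"
    by (rule DERIV_nonneg_imp_nondecreasing[OF l]) (use d D in force)
  then show "ln_G \<alpha> t l \<le> 0" by (simp add: ln_G_0)
  have "(\<integral>\<^sup>+s. ennreal (- ln_G' \<alpha> t s) * indicator {0..l} s \<partial>lborel) = ennreal (- ln_G \<alpha> t l - - ln_G \<alpha> t 0)"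
    by (rule nn_integral_FTC_Icc) (use l D d in auto)
  then have "ennreal (- ln_G \<alpha> t l) = (\<integral>\<^sup>+s. ennreal (- ln_G' \<alpha> t s) * indicator {0..l} s \<partial>lborel)"
    by (simp add: ln_G_0)
  also have "\<dots> = (\<integral>\<^sup>+s. \<integral>\<^sup>+x. ennreal (exp (- s * x) * levy_k \<alpha> t x) * indicator {0..l} s \<partial>lborel \<partial>lborel)"
    using l by (intro nn_integral_cong)
      (auto split: split_indicator simp: nn_integral_levy_k_1[symmetric])
  also have "\<dots> = (\<integral>\<^sup>+x. \<integral>\<^sup>+s. ennreal (exp (- s * x) * levy_k \<alpha> t x) * indicator {0..l} s \<partial>lborel \<partial>lborel)"
    by (rule lborel_pair.Fubini') measurable
  also have "\<dots> = (\<integral>\<^sup>+x. ennreal ((1 - exp (- l * x)) * (levy_k \<alpha> t x / x)) \<partial>lborel)"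
  proof (rule nn_integral_cong)
    fix x
    show "(\<integral>\<^sup>+s. ennreal (exp (- s * x) * levy_k \<alpha> t x) * indicator {0..l} s \<partial>lborel)
        = ennreal ((1 - exp (- l * x)) * (levy_k \<alpha> t x / x))"
    proof (cases "0 < x")
      case True
      have "(\<integral>\<^sup>+s. ennreal (exp (- s * x) * levy_k \<alpha> t x) * indicator {0..l} s \<partial>lborel)
          = ennreal (- exp (- l * x) / x * levy_k \<alpha> t x - - exp (- 0 * x) / x * levy_k \<alpha> t x)"
      proof (rule nn_integral_FTC_Icc[where F = "\<lambda>s. - exp (- s * x) / x * levy_k \<alpha> t x"])
        show "((\<lambda>s. - exp (- s * x) / x * levy_k \<alpha> t x) has_real_derivative exp (- s * x) * levy_k \<alpha> t x) (at s)" for s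
          using True by (auto intro!: derivative_eq_intros)
      qed (use l levy_k_nonneg' in auto)
      then show ?thesis by (simp add: left_diff_distrib diff_divide_distrib)
    qed (simp add: levy_k_eq_0[OF \<alpha>(1)])
  qed
  finally show "(\<integral>\<^sup>+x. ennreal ((1 - exp (- l * x)) * (levy_k \<alpha> t x / x)) \<partial>lborel) = ennreal (- ln_G \<alpha> t l)"
    by simp
qed

text \<open>The factor \<open>a\<close> multiplies the Levy density and \<open>b\<close> dilates the
  law, which turns \<open>levy_k \<alpha> t x\<close> into
  \<open>a * levy_k \<alpha> t (x / b)\<close> and preserves monotonicity.\<close>

lemma SD0_Rplus_exp_ln_G:
  assumes a: "0 < a" and b: "0 < b"
  shows "\<exists>M. SD0_Rplus M \<and> (\<forall>l\<ge>0. laplace_tr M l = exp (a * ln_G \<alpha> t (b * l)))"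
proof -
  define k where "k x = a * levy_k \<alpha> t (x / b)" for x
  have hb: "has_bochner_integral lborel (\<lambda>x. (1 - exp (- l * x)) * (if 0 < x then k x / x else 0))
      (- (a * ln_G \<alpha> t (b * l)))" if l: "0 \<le> l" for l
  proof -
    have bl: "0 \<le> b * l" using b l by simp
    have "has_bochner_integral lborel (\<lambda>x. (1 - exp (- (b * l) * x)) * (levy_k \<alpha> t x / x)) (- ln_G \<alpha> t (b * l))"
    proof (rule has_bochner_integral_nn_integral)
      have "0 \<le> (1 - exp (- (b * l) * x)) * (levy_k \<alpha> t x / x)" for x
        using levy_k_nonneg'[of x] levy_k_eq_0[OF \<alpha>(1), of x t] bl
        by (cases "0 < x") (auto intro!: mult_nonneg_nonneg divide_nonneg_nonneg)
      then show "AE x in lborel. 0 \<le> (1 - exp (- (b * l) * x)) * (levy_k \<alpha> t x / x)" by simp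
    qed (use nn_integral_levy_k[OF bl] in auto)
    then have "has_bochner_integral lborel
       (\<lambda>x. (1 - exp (- (b * l) * (0 + 1 / b * x))) * (levy_k \<alpha> t (0 + 1 / b * x) / (0 + 1 / b * x)))
       (- ln_G \<alpha> t (b * l) /\<^sub>R \<bar>1 / b\<bar>)"
      using b by (subst (asm) lborel_has_bochner_integral_real_affine_iff[of "1 / b" _ _ 0]) auto
    then have "has_bochner_integral lborel
       (\<lambda>x. a / b * ((1 - exp (- (b * l) * (0 + 1 / b * x))) * (levy_k \<alpha> t (0 + 1 / b * x) / (0 + 1 / b * x))))
       (a / b * (- ln_G \<alpha> t (b * l) /\<^sub>R \<bar>1 / b\<bar>))" by (rule has_bochner_integral_mult_right)
    also have "(\<lambda>x. a / b * ((1 - exp (- (b * l) * (0 + 1 / b * x))) * (levy_k \<alpha> t (0 + 1 / b * x) / (0 + 1 / b * x))))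
        = (\<lambda>x. (1 - exp (- l * x)) * (if 0 < x then k x / x else 0))"
    proof
      fix x
      have "x \<le> 0 \<Longrightarrow> levy_k \<alpha> t (x / b) = 0"
        using b by (intro levy_k_eq_0[OF \<alpha>(1)]) (simp add: divide_nonpos_pos)
      then show "a / b * ((1 - exp (- (b * l) * (0 + 1 / b * x))) * (levy_k \<alpha> t (0 + 1 / b * x) / (0 + 1 / b * x)))
          = (1 - exp (- l * x)) * (if 0 < x then k x / x else 0)"
        using b by (auto simp: k_def)
    qed
    also have "a / b * (- ln_G \<alpha> t (b * l) /\<^sub>R \<bar>1 / b\<bar>) = - (a * ln_G \<alpha> t (b * l))"
      using b by simp
    finally show ?thesis .
  qed
  have "\<exists>M. SD0_Rplus M \<and> (\<forall>l\<ge>0. laplace_tr M l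
     = exp (- (\<integral>x. (1 - exp (- l * x)) * (if 0 < x then k x / x else 0) \<partial>lborel)))"
  proof (rule SD0_Rplus_of_antimono)
    show "k \<in> borel_measurable borel" unfolding k_def by measurable
    show "0 \<le> k x" for x using a levy_k_nonneg' by (simp add: k_def)
    show "k y \<le> k x" if "0 < x" "x \<le> y" for x y
      unfolding k_def using that a b
      by (intro mult_left_mono levy_k_antimono \<alpha> t) (auto simp: divide_right_mono)
  qed (use hb in \<open>auto simp: has_bochner_integral_iff\<close>)
  with hb show ?thesis by (auto simp: has_bochner_integral_iff)
qed

end

section \<open>Necessary conditions from convexity\<close>

text \<open>Adding the tangent inequalities at \<open>x\<close> and \<open>x + h\<close> gives
  \<open>f' x \<le> f' (x + h)\<close>, whereas a negative \<open>D\<close> would make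
  \<open>f'\<close> drop just to the right of \<open>x\<close>.\<close>

lemma convex_on_second_deriv_nonneg:
  fixes f f' :: "real \<Rightarrow> real"
  assumes conv: "convex_on S f" and S: "open S"
    and d: "\<And>x. x \<in> S \<Longrightarrow> (f has_real_derivative f' x) (at x)"
    and d2: "(f' has_real_derivative D) (at x)" and x: "x \<in> S"
  shows "0 \<le> D"
proof (rule ccontr)
  assume "\<not> 0 \<le> D"
  then obtain e where e: "0 < e" "\<And>h. 0 < h \<Longrightarrow> h < e \<Longrightarrow> f' (x + h) < f' x"
    using DERIV_neg_dec_right[OF d2] by auto
  obtain r where r: "0 < r" "ball x r \<subseteq> S" using S x by (meson openE)
  define h where "h = min e r / 2"
  have h: "0 < h" "h < e" "x + h \<in> S" using e r by (auto simp: h_def dist_real_def subset_iff)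
  have tangent: "f' a * (b - a) \<le> f b - f a" if "a \<in> S" "b \<in> S" for a b
    using convex_on_imp_above_tangent[OF conv _ _ _ has_field_derivative_at_within[OF d[OF that(1)]]]
      that S convex_on_imp_convex[OF conv] by (simp add: interior_open convex_connected)
  have "f' x * h \<le> f' (x + h) * h"
    using tangent[OF x h(3)] tangent[OF h(3) x] by simp
  with e(2)[OF h(1,2)] h(1) show False by simp
qed

lemma ln_G_scaled_deriv:
  assumes "0 < \<alpha>" "0 < t" "0 < b" "0 < l"
  shows "((\<lambda>l. a * ln_G \<alpha> t (b * l)) has_real_derivative a * b * ln_G' \<alpha> t (b * l)) (at l)"
    and "((\<lambda>l. a * b * ln_G' \<alpha> t (b * l)) has_real_derivative a * b\<^sup>2 * ln_G'' \<alpha> t (b * l)) (at l)"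
proof -
  have bl: "0 \<le> b * l" using assms by simp
  have g: "((\<lambda>l. b * l) has_real_derivative b) (at l)" by (auto intro!: derivative_eq_intros)
  note d = ln_G_deriv[OF assms(1,2) bl]
  show "((\<lambda>l. a * ln_G \<alpha> t (b * l)) has_real_derivative a * b * ln_G' \<alpha> t (b * l)) (at l)"
    using DERIV_cmult[OF DERIV_chain2[where g = "\<lambda>l. b * l", OF d(1) g], of a] by (simp add: ac_simps)
  show "((\<lambda>l. a * b * ln_G' \<alpha> t (b * l)) has_real_derivative a * b\<^sup>2 * ln_G'' \<alpha> t (b * l)) (at l)"
    using DERIV_cmult[OF DERIV_chain2[where g = "\<lambda>l. b * l", OF d(2) g], of "a * b"]
    by (simp add: ac_simps power2_eq_square)
qed

text \<open>The second derivative is taken at \<open>l / b\<close> so that the dilation disappears.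
  The sign of \<open>a\<close> is left open, so negative multiples of \<open>ln_G\<close> are
  covered.\<close>

lemma ln_G''_nonneg_of_convex:
  assumes "0 < \<alpha>" "0 < t" "0 < b" "0 < l"
    and conv: "convex_on {0..} (\<lambda>l. a * ln_G \<alpha> t (b * l))"
  shows "0 \<le> a * ln_G'' \<alpha> t l"
proof -
  have "convex_on {0<..} (\<lambda>l. a * ln_G \<alpha> t (b * l))"
    using conv by (rule convex_on_subset) auto
  then have "0 \<le> a * b\<^sup>2 * ln_G'' \<alpha> t (b * (l / b))"
    by (rule convex_on_second_deriv_nonneg[where x = "l / b"])
       (use assms in \<open>auto simp del: times_divide_eq_right intro!: ln_G_scaled_deriv\<close>)
  then show ?thesis using assms by (auto simp: zero_le_mult_iff mult_le_0_iff)
qed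

lemma not_convex_neg_ln_G:
  assumes \<alpha>: "0 < \<alpha>" "\<alpha> < 1" and t: "0 < t" and ab: "0 < a" "0 < b"
  shows "\<not> convex_on {0..} (\<lambda>l. - a * ln_G \<alpha> t (b * l))"
proof
  assume "convex_on {0..} (\<lambda>l. - a * ln_G \<alpha> t (b * l))"
  from ln_G''_nonneg_of_convex[OF \<alpha>(1) t ab(2) _ this]
  have le: "ln_G'' \<alpha> t l \<le> 0" if "0 < l" for l
    using that ab by (auto simp: zero_le_mult_iff mult_le_0_iff)
  \<comment> \<open>Convexity controls \<open>ln_G''\<close> only at \<open>l > 0\<close>;
    continuity carries the bound to 0, where the value is explicit and positive.\<close>
  have "isCont (ln_G'' \<alpha> t) 0"
    unfolding ln_G''_def [abs_def]
    by (intro continuous_intros isCont_Polygamma) (use t pos_notin_nonpos_Ints in auto)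
  then have "((ln_G'' \<alpha> t) \<longlongrightarrow> ln_G'' \<alpha> t 0) (at_right 0)"
    unfolding isCont_def by (rule filterlim_mono[OF _ order_refl at_le]) simp
  then have "ln_G'' \<alpha> t 0 \<le> 0"
    by (rule tendsto_upperbound) (auto simp: eventually_at_right_less intro: le eventually_mono[OF eventually_at_right_less])
  moreover have "ln_G'' \<alpha> t 0 = \<alpha> * (1 - \<alpha>) * Polygamma 1 t"
    by (simp add: ln_G''_def algebra_simps power2_eq_square)
  moreover have "0 < Polygamma 1 t"
    using Polygamma_real_odd_pos[OF pos_notin_nonpos_Ints[OF t], of 1] by simp
  ultimately show False using \<alpha> by (simp add: mult_le_0_iff)
qed

text \<open>The two convexity hypotheses say that \<open>W\<close> is nonnegative and nondecreasing.
  The sign of its limit \<open>K\<close> gives \<open>1 / 2 \<le> t\<close>; that the limit is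
  approached from below gives the quadratic condition.\<close>

lemma t0_le_of_convex:
  assumes \<alpha>: "0 < \<alpha>" "\<alpha> < 1" and t: "0 < t" and ab: "0 < a" "0 < b"
    and conv: "convex_on {0..} (\<lambda>l. a * ln_G \<alpha> t (b * l))"
    and conv': "\<And>c. 0 < c \<Longrightarrow> c < 1 \<Longrightarrow>
        convex_on {0..} (\<lambda>l. a * ln_G \<alpha> t (b * l) - a * ln_G \<alpha> t (b * (c * l)))"
  shows "t0 \<le> t"
proof -
  define W where "W l = l\<^sup>2 * ln_G'' \<alpha> t l" for l
  define K where "K = (1 - \<alpha>) * (t - 1 / 2)"
  define B where "B = t\<^sup>2 - t + 1 / 6"
  define P where "P l = l ^ 3 * Polygamma 1 (l + t) - l\<^sup>2 - (1 / 2 - t) * l" for l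
  have W0: "0 \<le> W l" if "0 < l" for l
    using ln_G''_nonneg_of_convex[OF \<alpha>(1) t ab(2) that conv] ab by (simp add: W_def zero_le_mult_iff)
  \<comment> \<open>The second derivative of the difference is taken at \<open>l / b\<close>; after
    cancelling \<open>a * b^2\<close> and multiplying by \<open>l^2\<close> it compares
    \<open>W\<close> at \<open>c * l\<close> and \<open>l\<close>.\<close>
  have mono: "W (c * l) \<le> W l" if c: "0 < c" "c < 1" and l: "0 < l" for c l
  proof -
    have "convex_on {0<..} (\<lambda>l. a * ln_G \<alpha> t (b * l) - a * ln_G \<alpha> t (b * (c * l)))"
      using conv'[OF c] by (rule convex_on_subset) auto
    then have "convex_on {0<..} (\<lambda>l. a * ln_G \<alpha> t (b * l) - a * ln_G \<alpha> t (b * c * l))"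
      by (simp add: mult.assoc)
    moreover have "0 < b * c" using ab c by simp
    ultimately have "0 \<le> a * b\<^sup>2 * ln_G'' \<alpha> t (b * (l / b)) - a * (b * c)\<^sup>2 * ln_G'' \<alpha> t (b * c * (l / b))"
      using ab l \<alpha> t
      by (intro convex_on_second_deriv_nonneg[of "{0<..}" _
           "\<lambda>l. a * b * ln_G' \<alpha> t (b * l) - a * (b * c) * ln_G' \<alpha> t (b * c * l)" _ "l / b"])
         (auto simp del: times_divide_eq_right intro!: DERIV_diff ln_G_scaled_deriv)
    also have "\<dots> = a * b\<^sup>2 * (ln_G'' \<alpha> t l - c\<^sup>2 * ln_G'' \<alpha> t (c * l))"
      using ab by (simp add: power_mult_distrib algebra_simps)
    finally have "c\<^sup>2 * ln_G'' \<alpha> t (c * l) \<le> ln_G'' \<alpha> t l"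
      using ab by (auto simp: zero_le_mult_iff mult_le_0_iff)
    then have "l\<^sup>2 * (c\<^sup>2 * ln_G'' \<alpha> t (c * l)) \<le> l\<^sup>2 * ln_G'' \<alpha> t l" by (intro mult_left_mono) auto
    then show ?thesis by (simp add: W_def power_mult_distrib ac_simps)
  qed
  have P: "(P \<longlongrightarrow> B) at_top"
    unfolding P_def [abs_def] B_def by (rule Trigamma_expansion)
  have "filterlim (\<lambda>l. \<alpha> * l) at_top at_top"
    using \<alpha> by real_asymp
  from filterlim_compose[OF P this] have P': "((\<lambda>l. P (\<alpha> * l)) \<longlongrightarrow> B) at_top" .
  define E where "E l = \<alpha> * P l - P (\<alpha> * l) / \<alpha>" for l
  have E: "(E \<longlongrightarrow> \<alpha> * B - B / \<alpha>) at_top"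
    unfolding E_def [abs_def] using \<alpha> by (intro tendsto_intros P P') auto
  \<comment> \<open>The quadratic terms of \<open>\<alpha> * P l\<close> and
    \<open>P (\<alpha> * l) / \<alpha>\<close> cancel and the linear ones combine to
    \<open>- K * l\<close>, so \<open>E\<close> measures the \<open>1 / l\<close> term of
    \<open>W\<close>.\<close>
  have EW: "E l = l * (W l - K)" for l
    using \<alpha> by (simp add: E_def W_def K_def P_def ln_G''_def field_simps power2_eq_square power3_eq_cube)
  have "((\<lambda>l. E l * (1 / l)) \<longlongrightarrow> (\<alpha> * B - B / \<alpha>) * 0) at_top"
    by (intro tendsto_mult E) real_asymp
  then have "((\<lambda>l. K + E l * (1 / l)) \<longlongrightarrow> K + (\<alpha> * B - B / \<alpha>) * 0) at_top"
    by (intro tendsto_add tendsto_const)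
  moreover have "\<forall>\<^sub>F l in at_top. K + E l * (1 / l) = W l"
    using eventually_gt_at_top[of 0] by eventually_elim (simp add: EW)
  ultimately have W: "(W \<longlongrightarrow> K) at_top" by (simp add: tendsto_cong)
  have "0 \<le> K"
    by (rule tendsto_lowerbound[OF W])
       (use W0 in \<open>auto intro: eventually_mono[OF eventually_gt_at_top[of 0]]\<close>)
  then have "1 / 2 \<le> t" using \<alpha> by (simp add: K_def zero_le_mult_iff)
  \<comment> \<open>A nondecreasing function stays below its limit; \<open>mono\<close> is applied
    with ratio \<open>l / m\<close>.\<close>
  have "W l \<le> K" if l: "0 < l" for l
  proof (rule tendsto_lowerbound[OF W])
    show "\<forall>\<^sub>F m in at_top. W l \<le> W m"
      using eventually_gt_at_top[of l]
    proof eventually_elim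
      case (elim m)
      then show ?case using mono[of "l / m" m] l by simp
    qed
  qed simp
  then have "E l \<le> 0" if "0 < l" for l using that by (simp add: EW mult_le_0_iff)
  then have "\<alpha> * B - B / \<alpha> \<le> 0"
    by (intro tendsto_upperbound[OF E]) (auto intro: eventually_mono[OF eventually_gt_at_top[of 0]])
  moreover have "\<alpha> * B - B / \<alpha> = - ((1 / \<alpha> - \<alpha>) * B)" by (simp add: algebra_simps)
  moreover have "0 < 1 / \<alpha> - \<alpha>" using \<alpha> mult_strict_mono[of \<alpha> 1 \<alpha> 1] by (simp add: field_simps)
  ultimately have "0 \<le> B" by (simp add: zero_le_mult_iff)
  with \<open>1 / 2 \<le> t\<close> show "t0 \<le> t" unfolding B_def by (rule t0_leI)
qed

lemma SD0_Rplus_exp_ln_G_iff: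
  assumes \<alpha>: "0 < \<alpha>" "\<alpha> < 1" and t: "0 < t" and ab: "0 < a" "0 < b"
  shows "(\<exists>M. SD0_Rplus M \<and> (\<forall>l\<ge>0. laplace_tr M l = exp (a * ln_G \<alpha> t (b * l)))) \<longleftrightarrow> t0 \<le> t"
proof
  assume "\<exists>M. SD0_Rplus M \<and> (\<forall>l\<ge>0. laplace_tr M l = exp (a * ln_G \<alpha> t (b * l)))"
  then obtain M where M: "SD0_Rplus M" and L: "\<And>l. 0 \<le> l \<Longrightarrow> laplace_tr M l = exp (a * ln_G \<alpha> t (b * l))"
    by blast
  show "t0 \<le> t"
  proof (rule t0_le_of_convex[OF \<alpha> t ab])
    show "convex_on {0..} (\<lambda>l. a * ln_G \<alpha> t (b * l))"
      by (rule convex_on_eq_on[OF SD0_Rplus_ln_laplace_tr_convex(1)[OF M]]) (simp add: L)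
    show "convex_on {0..} (\<lambda>l. a * ln_G \<alpha> t (b * l) - a * ln_G \<alpha> t (b * (c * l)))"
      if "0 < c" "c < 1" for c
      by (rule convex_on_eq_on[OF SD0_Rplus_ln_laplace_tr_convex(2)[OF M that]]) (use that in \<open>simp add: L\<close>)
  qed
next
  assume "t0 \<le> t"
  then show "\<exists>M. SD0_Rplus M \<and> (\<forall>l\<ge>0. laplace_tr M l = exp (a * ln_G \<alpha> t (b * l)))"
    using \<alpha> ab by (intro SD0_Rplus_exp_ln_G)
qed

lemma not_SD0_Rplus_exp_neg_ln_G:
  assumes "0 < \<alpha>" "\<alpha> < 1" "0 < t" "0 < a" "0 < b"
  shows "\<not> (\<exists>M. SD0_Rplus M \<and> (\<forall>l\<ge>0. laplace_tr M l = exp (- a * ln_G \<alpha> t (b * l))))"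
proof
  assume "\<exists>M. SD0_Rplus M \<and> (\<forall>l\<ge>0. laplace_tr M l = exp (- a * ln_G \<alpha> t (b * l)))"
  then obtain M where M: "SD0_Rplus M" and L: "\<And>l. 0 \<le> l \<Longrightarrow> laplace_tr M l = exp (- a * ln_G \<alpha> t (b * l))"
    by blast
  have "convex_on {0..} (\<lambda>l. - a * ln_G \<alpha> t (b * l))"
    by (rule convex_on_eq_on[OF SD0_Rplus_ln_laplace_tr_convex(1)[OF M]]) (simp add: L)
  with not_convex_neg_ln_G[OF assms] show False by blast
qed

theorem theorem2:
  fixes \<alpha> t :: real
  assumes "0 < \<alpha>" and "\<alpha> \<noteq> 1" and "0 < t"
  shows "((\<exists>M. SD0_Rplus M \<and> (\<forall>lam\<ge>0. laplace_tr M lam = G \<alpha> t lam))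
           \<longleftrightarrow> (\<alpha> < 1 \<and> t0 \<le> t))
       \<and> ((\<exists>M. SD0_Rplus M \<and> (\<forall>lam\<ge>0. laplace_tr M lam = 1 / G \<alpha> t lam))
           \<longleftrightarrow> (1 < \<alpha> \<and> t0 \<le> t))"
proof (cases "\<alpha> < 1")
  case True
  have "G \<alpha> t l = exp (1 * ln_G \<alpha> t (1 * l))" "1 / G \<alpha> t l = exp (- 1 * ln_G \<alpha> t (1 * l))" if "0 \<le> l" for l
    using G_eq_exp[OF assms(1,3) that] by (simp_all add: exp_minus inverse_eq_divide)
  then show ?thesis
    using SD0_Rplus_exp_ln_G_iff[OF assms(1) True assms(3), of 1 1]
      not_SD0_Rplus_exp_neg_ln_G[OF assms(1) True assms(3), of 1 1] True by simp
next
  case False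
  \<comment> \<open>Passing to 1/\<alpha> exchanges the roles of \<open>G\<close> and
    \<open>1 / G\<close>, with \<alpha> serving both as factor and as dilation.\<close>
  then have \<alpha>: "1 < \<alpha>" "0 < 1 / \<alpha>" "1 / \<alpha> < 1" using assms by auto
  have "G \<alpha> t l = exp (- \<alpha> * ln_G (1 / \<alpha>) t (\<alpha> * l))" "1 / G \<alpha> t l = exp (\<alpha> * ln_G (1 / \<alpha>) t (\<alpha> * l))"
    if "0 \<le> l" for l
    using G_eq_exp[OF assms(1,3) that] ln_G_inverse[OF assms(1), of t l]
    by (simp_all add: exp_minus inverse_eq_divide)
  then show ?thesis
    using SD0_Rplus_exp_ln_G_iff[OF \<alpha>(2,3) assms(3,1,1)]
      not_SD0_Rplus_exp_neg_ln_G[OF \<alpha>(2,3) assms(3,1,1)] \<alpha> by simp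
qed

end
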